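(* Let $H$ be a finite-dimensional semisimple Hopf algebra over $\mathbb{C}$ with (nonzero left) integral $\lambda:H\to\mathbb{C}$. If $K$ is a Hopf subalgebra of $H$ and $L$ is a left coideal subalgebra of $H$, then $\lambda|_{L+K}$ is nondegenerate.
   Context: A left integral is a linear map $\lambda:H\to\mathbb{C}$ with $h_{(1)}\lambda(h_{(2)})=\lambda(h)1_H$ for all $h\in H$ (Sweedler notation); the space of left integrals is one-dimensional and $\lambda$ denotes a nonzero one. A left coideal subalgebra is a unital subalgebra $L\subseteq H$ with $\Delta(L)\subseteq H\otimes L$. For a subspace $V\subseteq H$, "$\lambda|_V$ is nondegenerate" means that the restriction to $V\times V$ of the bilinear form $(x,y)\mapsto\lambda(xy)$ is nondegenerate. $L+K$ is the sum of subspaces. *)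

theory Defs
  imports Complex_Main "HOL-Library.Poly_Mapping"
begin

section \<open>Complex vector spaces and algebras\<close>

class scaleC =
  fixes scaleC :: "complex \<Rightarrow> 'a \<Rightarrow> 'a"  (infixr "*\<^sub>C" 75)

class complex_vector = scaleC + ab_group_add +
  assumes scaleC_add_right: "a *\<^sub>C (x + y) = a *\<^sub>C x + a *\<^sub>C y"
    and scaleC_add_left: "(a + b) *\<^sub>C x = a *\<^sub>C x + b *\<^sub>C x"
    and scaleC_scaleC: "a *\<^sub>C b *\<^sub>C x = (a * b) *\<^sub>C x"
    and scaleC_one: "1 *\<^sub>C x = x"

global_interpretation cvec: vector_space "scaleC :: complex \<Rightarrow> 'a \<Rightarrow> 'a::complex_vector"
  by unfold_locales (fact scaleC_add_right scaleC_add_left scaleC_scaleC scaleC_one)+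

class complex_algebra_1 = complex_vector + ring_1 +
  assumes mult_scaleC_left: "(a *\<^sub>C x) * y = a *\<^sub>C (x * y)"
    and mult_scaleC_right: "x * (a *\<^sub>C y) = a *\<^sub>C (x * y)"

instantiation complex :: complex_algebra_1
begin

definition scaleC_complex :: "complex \<Rightarrow> complex \<Rightarrow> complex"
  where "scaleC_complex a x = a * x"

instance
  by standard (auto simp: scaleC_complex_def algebra_simps)

end

abbreviation clinear :: "('a::complex_vector \<Rightarrow> 'b::complex_vector) \<Rightarrow> bool"
  where "clinear \<equiv> Vector_Spaces.linear scaleC scaleC"

lemma clinear_iff:
  "clinear f \<longleftrightarrow> (\<forall>x y. f (x + y) = f x + f y) \<and> (\<forall>c x. f (c *\<^sub>C x) = c *\<^sub>C f x)"
  by (auto simp: Vector_Spaces.linear_def module_hom_def module_hom_axioms_def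
    cvec.vector_space_axioms cvec.module_axioms)

definition cbilinear :: "('a::complex_vector \<Rightarrow> 'b::complex_vector \<Rightarrow> 'c::complex_vector) \<Rightarrow> bool"
  where "cbilinear B \<longleftrightarrow> (\<forall>y. clinear (\<lambda>x. B x y)) \<and> (\<forall>x. clinear (B x))"


section \<open>The algebraic tensor product\<close>

text \<open>
  The tensor product is the free vector space on pairs, modulo the span of the bilinearity
  relations. Finitely supported functions serve as the free vector space.
\<close>

instantiation poly_mapping :: (type, complex_vector) complex_vector
begin

lift_definition scaleC_poly_mapping ::
    "complex \<Rightarrow> ('a \<Rightarrow>\<^sub>0 'b) \<Rightarrow> ('a \<Rightarrow>\<^sub>0 'b)"
  is "\<lambda>c f k. c *\<^sub>C f k"
  by (erule rev_finite_subset) auto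

instance
  by standard
    (transfer; auto simp: scaleC_add_right scaleC_add_left scaleC_scaleC scaleC_one)+

end

abbreviation pair_basis :: "'a \<Rightarrow> 'b \<Rightarrow> ('a \<times> 'b) \<Rightarrow>\<^sub>0 complex"
  where "pair_basis x y \<equiv> Poly_Mapping.single (x, y) 1"

definition tensor_relations ::
    "(('a::complex_vector \<times> 'b::complex_vector) \<Rightarrow>\<^sub>0 complex) set"
  where "tensor_relations =
      {pair_basis (x + x') y - pair_basis x y - pair_basis x' y | x x' y. True}
    \<union> {pair_basis x (y + y') - pair_basis x y - pair_basis x y' | x y y'. True}
    \<union> {pair_basis (c *\<^sub>C x) y - c *\<^sub>C pair_basis x y | c x y. True}
    \<union> {pair_basis x (c *\<^sub>C y) - c *\<^sub>C pair_basis x y | c x y. True}"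

definition tensor_eq ::
    "(('a::complex_vector \<times> 'b::complex_vector) \<Rightarrow>\<^sub>0 complex)
      \<Rightarrow> (('a \<times> 'b) \<Rightarrow>\<^sub>0 complex) \<Rightarrow> bool"
  where "tensor_eq s t \<longleftrightarrow> s - t \<in> cvec.span tensor_relations"

lemma equivp_tensor_eq: "equivp tensor_eq"
proof (intro equivpI reflpI sympI transpI)
  fix s t u :: "('a::complex_vector \<times> 'b::complex_vector) \<Rightarrow>\<^sub>0 complex"
  show "tensor_eq s s"
    by (simp add: tensor_eq_def cvec.span_zero)
  show "tensor_eq t s" if "tensor_eq s t"
    using cvec.span_neg[OF that[unfolded tensor_eq_def]] by (simp add: tensor_eq_def)
  show "tensor_eq s u" if "tensor_eq s t" "tensor_eq t u"
    using cvec.span_add[OF that[unfolded tensor_eq_def]] by (simp add: tensor_eq_def)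
qed

quotient_type (overloaded) ('a, 'b) tensor  (infixr "\<otimes>" 70) =
    "('a::complex_vector \<times> 'b::complex_vector) \<Rightarrow>\<^sub>0 complex" / tensor_eq
  by (rule equivp_tensor_eq)

instantiation tensor :: (complex_vector, complex_vector) complex_vector
begin

lift_definition zero_tensor :: "'a \<otimes> 'b" is 0 .

lift_definition plus_tensor :: "'a \<otimes> 'b \<Rightarrow> 'a \<otimes> 'b \<Rightarrow> 'a \<otimes> 'b" is "(+)"
  by (simp only: tensor_eq_def add_diff_add cvec.span_add)

lift_definition uminus_tensor :: "'a \<otimes> 'b \<Rightarrow> 'a \<otimes> 'b" is uminus
  by (simp only: tensor_eq_def minus_diff_minus cvec.span_neg)

lift_definition minus_tensor :: "'a \<otimes> 'b \<Rightarrow> 'a \<otimes> 'b \<Rightarrow> 'a \<otimes> 'b" is "(-)"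
proof -
  fix s s' t t' :: "('a \<times> 'b) \<Rightarrow>\<^sub>0 complex"
  assume "tensor_eq s s'" "tensor_eq t t'"
  from cvec.span_diff[OF this[unfolded tensor_eq_def]]
  show "tensor_eq (s - t) (s' - t')"
    by (simp add: tensor_eq_def algebra_simps)
qed

lift_definition scaleC_tensor :: "complex \<Rightarrow> 'a \<otimes> 'b \<Rightarrow> 'a \<otimes> 'b" is scaleC
  by (simp only: tensor_eq_def cvec.scale_right_diff_distrib[symmetric] cvec.span_scale)

instance
proof
  fix s t u :: "'a \<otimes> 'b" and a b :: complex
  show "s + t + u = s + (t + u)"
    by transfer (simp add: add.assoc tensor_eq_def cvec.span_zero)
  show "s + t = t + s"
    by transfer (simp add: add.commute tensor_eq_def cvec.span_zero)
  show "0 + s = s"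
    by transfer (simp add: tensor_eq_def cvec.span_zero)
  show "- s + s = 0"
    by transfer (simp add: tensor_eq_def cvec.span_zero)
  show "s - t = s + - t"
    by transfer (simp add: tensor_eq_def cvec.span_zero)
  show "a *\<^sub>C (s + t) = a *\<^sub>C s + a *\<^sub>C t"
    by transfer (simp add: scaleC_add_right tensor_eq_def cvec.span_zero)
  show "(a + b) *\<^sub>C s = a *\<^sub>C s + b *\<^sub>C s"
    by transfer (simp add: scaleC_add_left tensor_eq_def cvec.span_zero)
  show "a *\<^sub>C b *\<^sub>C s = (a * b) *\<^sub>C s"
    by transfer (simp add: scaleC_scaleC tensor_eq_def cvec.span_zero)
  show "1 *\<^sub>C s = s"
    by transfer (simp add: scaleC_one tensor_eq_def cvec.span_zero)
qed

end

lift_definition tensor_of ::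
    "'a::complex_vector \<Rightarrow> 'b::complex_vector \<Rightarrow> 'a \<otimes> 'b"  (infixr "\<otimes>" 70)
  is pair_basis .

text \<open>
  \<open>tensor_lift B\<close> is the linear map on the tensor product induced by \<open>B\<close>. It is computed on an
  arbitrary representative, so it is meaningful only when \<open>B\<close> is bilinear.
\<close>

definition free_lift ::
    "('a \<Rightarrow> 'b \<Rightarrow> 'c::complex_vector) \<Rightarrow> (('a \<times> 'b) \<Rightarrow>\<^sub>0 complex) \<Rightarrow> 'c"
  where "free_lift B s =
    (\<Sum>p\<in>Poly_Mapping.keys s. Poly_Mapping.lookup s p *\<^sub>C B (fst p) (snd p))"

definition tensor_lift ::
    "('a::complex_vector \<Rightarrow> 'b::complex_vector \<Rightarrow> 'c::complex_vector) \<Rightarrow> 'a \<otimes> 'b \<Rightarrow> 'c"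
  where "tensor_lift B t = free_lift B (rep_tensor t)"

lemma free_lift_superset:
  assumes "finite A" "Poly_Mapping.keys s \<subseteq> A"
  shows "free_lift B s = (\<Sum>p\<in>A. Poly_Mapping.lookup s p *\<^sub>C B (fst p) (snd p))"
  unfolding free_lift_def
  by (rule sum.mono_neutral_left[OF assms]) (auto simp: in_keys_iff)

lemma free_lift_linear: "clinear (free_lift B)"
proof -
  have "free_lift B (s + t) = free_lift B s + free_lift B t" for s t
  proof -
    let ?A = "Poly_Mapping.keys s \<union> Poly_Mapping.keys t"
    have "free_lift B s = (\<Sum>p\<in>?A. Poly_Mapping.lookup s p *\<^sub>C B (fst p) (snd p))"
      "free_lift B t = (\<Sum>p\<in>?A. Poly_Mapping.lookup t p *\<^sub>C B (fst p) (snd p))"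
      "free_lift B (s + t) =
        (\<Sum>p\<in>?A. Poly_Mapping.lookup (s + t) p *\<^sub>C B (fst p) (snd p))"
      using keys_add[of s t] by (auto intro!: free_lift_superset)
    then show ?thesis
      by (simp add: lookup_add scaleC_add_left sum.distrib)
  qed
  moreover have "free_lift B (c *\<^sub>C s) = c *\<^sub>C free_lift B s" for c s
  proof -
    have l: "Poly_Mapping.lookup (c *\<^sub>C s) p = c * Poly_Mapping.lookup s p" for p
      by transfer (simp add: scaleC_complex_def)
    then have "free_lift B (c *\<^sub>C s) =
        (\<Sum>p\<in>Poly_Mapping.keys s. Poly_Mapping.lookup (c *\<^sub>C s) p *\<^sub>C B (fst p) (snd p))"
      by (intro free_lift_superset) (auto simp: in_keys_iff)
    then show ?thesis
      by (simp add: l free_lift_def cvec.scale_sum_right scaleC_scaleC)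
  qed
  ultimately show ?thesis
    by (simp add: clinear_iff)
qed

lemma free_lift_pair_basis [simp]: "free_lift B (pair_basis x y) = B x y"
  by (simp add: free_lift_def scaleC_one)

lemma free_lift_relations:
  assumes "cbilinear B" "s \<in> cvec.span tensor_relations"
  shows "free_lift B s = 0"
proof -
  interpret L: Vector_Spaces.linear scaleC scaleC "free_lift B"
    by (rule free_lift_linear)
  have "B (x + x') y = B x y + B x' y" "B x (y + y') = B x y + B x y'"
    "B (c *\<^sub>C x) y = c *\<^sub>C B x y" "B x (c *\<^sub>C y) = c *\<^sub>C B x y" for x x' y y' c
    using assms(1) by (auto simp: cbilinear_def clinear_iff)
  then have "\<forall>r\<in>tensor_relations. free_lift B r = 0"
    unfolding tensor_relations_def by (auto simp: L.diff L.scale)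
  then show ?thesis
    using assms(2) L.eq_0_on_span by blast
qed

lemma tensor_lift_abs:
  assumes "cbilinear B"
  shows "tensor_lift B (abs_tensor s) = free_lift B s"
proof -
  interpret L: Vector_Spaces.linear scaleC scaleC "free_lift B"
    by (rule free_lift_linear)
  have "rep_tensor (abs_tensor s) - s \<in> cvec.span tensor_relations"
    using rep_abs_rsp_left[OF Quotient3_tensor, of s s]
    by (simp add: tensor_eq_def cvec.span_zero)
  from free_lift_relations[OF assms this] show ?thesis
    by (simp add: tensor_lift_def L.diff)
qed

lemma tensor_lift_tensor_of:
  "cbilinear B \<Longrightarrow> tensor_lift B (x \<otimes> y) = B x y"
  by (simp add: tensor_of.abs_eq tensor_lift_abs)

lemma tensor_lift_linear:
  assumes "cbilinear B"
  shows "clinear (tensor_lift B)"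
proof -
  interpret L: Vector_Spaces.linear scaleC scaleC "free_lift B"
    by (rule free_lift_linear)
  have "tensor_lift B (s + t) = tensor_lift B s + tensor_lift B t" for s t
    by (induct s rule: tensor.abs_induct, induct t rule: tensor.abs_induct)
       (simp add: plus_tensor.abs_eq tensor_lift_abs[OF assms] L.add)
  moreover have "tensor_lift B (c *\<^sub>C s) = c *\<^sub>C tensor_lift B s" for c s
    by (induct s rule: tensor.abs_induct)
       (simp add: scaleC_tensor.abs_eq tensor_lift_abs[OF assms] L.scale)
  ultimately show ?thesis
    by (simp add: clinear_iff)
qed

lemma cbilinear_tensor_of: "cbilinear (\<otimes>)"
proof -
  have "(x + x') \<otimes> y = x \<otimes> y + x' \<otimes> y" for x x' :: 'a and y :: 'b
    by transfer (unfold tensor_eq_def tensor_relations_def diff_diff_eq[symmetric],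
      rule cvec.span_base, blast)
  moreover have "x \<otimes> (y + y') = x \<otimes> y + x \<otimes> y'" for x :: 'a and y y' :: 'b
    by transfer (unfold tensor_eq_def tensor_relations_def diff_diff_eq[symmetric],
      rule cvec.span_base, blast)
  moreover have "(c *\<^sub>C x) \<otimes> y = c *\<^sub>C (x \<otimes> y)" for c and x :: 'a and y :: 'b
    by transfer (unfold tensor_eq_def tensor_relations_def, rule cvec.span_base, blast)
  moreover have "x \<otimes> (c *\<^sub>C y) = c *\<^sub>C (x \<otimes> y)" for c and x :: 'a and y :: 'b
    by transfer (unfold tensor_eq_def tensor_relations_def, rule cvec.span_base, blast)
  ultimately show ?thesis
    by (simp add: cbilinear_def clinear_iff)
qed

lemma tensor_of_simps:
  "(x + x') \<otimes> y = x \<otimes> y + x' \<otimes> y" "x \<otimes> (y + y') = x \<otimes> y + x \<otimes> y'"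
  "(c *\<^sub>C x) \<otimes> y = c *\<^sub>C (x \<otimes> y)" "x \<otimes> (c *\<^sub>C y) = c *\<^sub>C (x \<otimes> y)"
  by (simp_all add: cbilinear_tensor_of[unfolded cbilinear_def clinear_iff])

definition tensor_map ::
    "('a::complex_vector \<Rightarrow> 'c::complex_vector) \<Rightarrow> ('b::complex_vector \<Rightarrow> 'd::complex_vector)
      \<Rightarrow> 'a \<otimes> 'b \<Rightarrow> 'c \<otimes> 'd"
  where "tensor_map f g = tensor_lift (\<lambda>x y. f x \<otimes> g y)"

definition tensor_assoc ::
    "('a::complex_vector \<otimes> 'b::complex_vector) \<otimes> 'c::complex_vector \<Rightarrow> 'a \<otimes> ('b \<otimes> 'c)"
  where "tensor_assoc = tensor_lift (\<lambda>t z. tensor_lift (\<lambda>x y. x \<otimes> (y \<otimes> z)) t)"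

definition tensor_mult ::
    "'a::complex_algebra_1 \<otimes> 'b::complex_algebra_1 \<Rightarrow> 'a \<otimes> 'b \<Rightarrow> 'a \<otimes> 'b"
  where "tensor_mult s t =
    tensor_lift (\<lambda>a b. tensor_lift (\<lambda>c d. (a * c) \<otimes> (b * d)) t) s"

lemma tensor_lift_simps:
  assumes "cbilinear B"
  shows "tensor_lift B (s + t) = tensor_lift B s + tensor_lift B t"
    and "tensor_lift B (c *\<^sub>C s) = c *\<^sub>C tensor_lift B s"
  using tensor_lift_linear[OF assms] by (auto simp: clinear_iff)

lemma tensor_lift_combination:
  assumes "cbilinear B" "cbilinear C" "cbilinear D"
    and "\<And>x y. B x y = a *\<^sub>C C x y + b *\<^sub>C D x y"
  shows "tensor_lift B t = a *\<^sub>C tensor_lift C t + b *\<^sub>C tensor_lift D t"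
proof (induct t rule: tensor.abs_induct)
  case (1 s)
  show ?case
    by (simp add: tensor_lift_abs[OF assms(1)] tensor_lift_abs[OF assms(2)]
      tensor_lift_abs[OF assms(3)])
      (simp add: free_lift_def assms(4) scaleC_add_right sum.distrib cvec.scale_sum_right
        scaleC_scaleC mult.commute)
qed

lemma cbilinear_lift:
  assumes "\<And>z. cbilinear (\<lambda>x y. B x y z)" "\<And>x y. clinear (B x y)"
  shows "cbilinear (\<lambda>t z. tensor_lift (\<lambda>x y. B x y z) t)"
proof -
  have "tensor_lift (\<lambda>x y. B x y (z + z')) t =
      1 *\<^sub>C tensor_lift (\<lambda>x y. B x y z) t + 1 *\<^sub>C tensor_lift (\<lambda>x y. B x y z') t" for z z' t
    using assms(2) by (intro tensor_lift_combination assms(1)) (simp add: clinear_iff scaleC_one)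
  moreover have "tensor_lift (\<lambda>x y. B x y (c *\<^sub>C z)) t =
      c *\<^sub>C tensor_lift (\<lambda>x y. B x y z) t + 0 *\<^sub>C tensor_lift (\<lambda>x y. B x y z) t" for c z t
    using assms(2) by (intro tensor_lift_combination assms(1)) (simp add: clinear_iff)
  ultimately show ?thesis
    using tensor_lift_linear[OF assms(1)]
    by (simp add: cbilinear_def clinear_iff scaleC_one)
qed

lemma tensor_map_tensor_of:
  "clinear f \<Longrightarrow> clinear g \<Longrightarrow> tensor_map f g (x \<otimes> y) = f x \<otimes> g y"
  unfolding tensor_map_def
  by (rule tensor_lift_tensor_of) (simp add: cbilinear_def clinear_iff tensor_of_simps)

lemma tensor_assoc_tensor_of: "tensor_assoc ((x \<otimes> y) \<otimes> z) = x \<otimes> (y \<otimes> z)"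
proof -
  have b: "cbilinear (\<lambda>x y. x \<otimes> (y \<otimes> z))" for z :: 'c
    by (simp add: cbilinear_def clinear_iff tensor_of_simps)
  have "cbilinear (\<lambda>t z. tensor_lift (\<lambda>(x::'a) (y::'b). x \<otimes> (y \<otimes> (z::'c))) t)"
    by (rule cbilinear_lift[OF b]) (simp add: clinear_iff tensor_of_simps)
  then show ?thesis
    unfolding tensor_assoc_def by (simp add: tensor_lift_tensor_of b)
qed

lemma tensor_mult_tensor_of:
  "tensor_mult (a \<otimes> b) (c \<otimes> d) = (a * c) \<otimes> (b * d)"
proof -
  have b: "cbilinear (\<lambda>c d. (a * c) \<otimes> (b * d))" for a :: 'a and b :: 'b
    by (simp add: cbilinear_def clinear_iff tensor_of_simps distrib_left mult_scaleC_right)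
  have "cbilinear (\<lambda>a b. tensor_lift (\<lambda>c d. ((a::'a) * c) \<otimes> ((b::'b) * d)) t)" for t
  proof -
    have "tensor_lift (\<lambda>c d. ((a + a') * c) \<otimes> (b * d)) t =
        1 *\<^sub>C tensor_lift (\<lambda>c d. (a * c) \<otimes> (b * d)) t
          + 1 *\<^sub>C tensor_lift (\<lambda>c d. (a' * c) \<otimes> (b * d)) t" for a a' :: 'a and b :: 'b
      by (intro tensor_lift_combination b) (simp add: distrib_right tensor_of_simps scaleC_one)
    moreover have "tensor_lift (\<lambda>c d. (a * c) \<otimes> ((b + b') * d)) t =
        1 *\<^sub>C tensor_lift (\<lambda>c d. (a * c) \<otimes> (b * d)) t
          + 1 *\<^sub>C tensor_lift (\<lambda>c d. (a * c) \<otimes> (b' * d)) t" for a :: 'a and b b' :: 'b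
      by (intro tensor_lift_combination b) (simp add: distrib_right tensor_of_simps scaleC_one)
    moreover have "tensor_lift (\<lambda>c d. ((k *\<^sub>C a) * c) \<otimes> (b * d)) t =
        k *\<^sub>C tensor_lift (\<lambda>c d. (a * c) \<otimes> (b * d)) t
          + 0 *\<^sub>C tensor_lift (\<lambda>c d. (a * c) \<otimes> (b * d)) t" for k and a :: 'a and b :: 'b
      by (intro tensor_lift_combination b) (simp add: mult_scaleC_left tensor_of_simps)
    moreover have "tensor_lift (\<lambda>c d. (a * c) \<otimes> ((k *\<^sub>C b) * d)) t =
        k *\<^sub>C tensor_lift (\<lambda>c d. (a * c) \<otimes> (b * d)) t
          + 0 *\<^sub>C tensor_lift (\<lambda>c d. (a * c) \<otimes> (b * d)) t" for k and a :: 'a and b :: 'b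
      by (intro tensor_lift_combination b) (simp add: mult_scaleC_left tensor_of_simps)
    ultimately show ?thesis
      by (simp add: cbilinear_def clinear_iff scaleC_one)
  qed
  from tensor_lift_tensor_of[OF this] have "tensor_mult (a \<otimes> b) (c \<otimes> d) =
      tensor_lift (\<lambda>c d. (a * c) \<otimes> (b * d)) (c \<otimes> d)"
    unfolding tensor_mult_def .
  then show ?thesis
    by (simp only: tensor_lift_tensor_of[OF b])
qed

text \<open>
  For subspaces \<open>V\<close> and \<open>W\<close> the following is the image of their tensor product in the ambient
  one; over a field this image is isomorphic to the tensor product of \<open>V\<close> and \<open>W\<close>.
\<close>

definition tensor_space ::
    "'a::complex_vector set \<Rightarrow> 'b::complex_vector set \<Rightarrow> ('a \<otimes> 'b) set"
  where "tensor_space V W = cvec.span {x \<otimes> y | x y. x \<in> V \<and> y \<in> W}"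


section \<open>Semisimple algebras\<close>

definition left_ideal :: "'a::complex_algebra_1 set \<Rightarrow> bool"
  where "left_ideal I \<longleftrightarrow> cvec.subspace I \<and> (\<forall>a. \<forall>x\<in>I. a * x \<in> I)"

definition simple_left_ideal :: "'a::complex_algebra_1 set \<Rightarrow> bool"
  where "simple_left_ideal I \<longleftrightarrow>
    left_ideal I \<and> I \<noteq> {0} \<and> (\<forall>J. left_ideal J \<and> J \<subseteq> I \<longrightarrow> J = {0} \<or> J = I)"

text \<open>
  The left regular module is semisimple, i.e. it is the sum of its simple submodules.
\<close>

definition semisimple_algebra :: "'a::complex_algebra_1 itself \<Rightarrow> bool"
  where "semisimple_algebra _ \<longleftrightarrow>
    cvec.span (\<Union>{I :: 'a set. simple_left_ideal I}) = UNIV"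

definition fin_dim :: "'a::complex_vector itself \<Rightarrow> bool"
  where "fin_dim _ \<longleftrightarrow> (\<exists>B :: 'a set. finite B \<and> cvec.span B = UNIV)"


section \<open>Hopf algebras\<close>

text \<open>
  An expression in Sweedler notation in which \<open>h\<^sub>(\<^sub>1\<^sub>)\<close> and \<open>h\<^sub>(\<^sub>2\<^sub>)\<close> are put into the two arguments
  of a bilinear map \<open>B\<close> is rendered as \<open>tensor_lift B (\<Delta> h)\<close>.
\<close>

locale hopf_algebra =
  fixes \<Delta> :: "'h::complex_algebra_1 \<Rightarrow> 'h \<otimes> 'h"
    and \<epsilon> :: "'h \<Rightarrow> complex"
    and S :: "'h \<Rightarrow> 'h"
  assumes comult_linear: "clinear \<Delta>"
    and counit_linear: "clinear \<epsilon>"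
    and antipode_linear: "clinear S"
    and coassoc: "tensor_assoc (tensor_map \<Delta> id (\<Delta> h)) = tensor_map id \<Delta> (\<Delta> h)"
    and counit_left: "tensor_lift (\<lambda>x y. \<epsilon> x *\<^sub>C y) (\<Delta> h) = h"
    and counit_right: "tensor_lift (\<lambda>x y. \<epsilon> y *\<^sub>C x) (\<Delta> h) = h"
    and comult_mult: "\<Delta> (g * h) = tensor_mult (\<Delta> g) (\<Delta> h)"
    and comult_one: "\<Delta> 1 = 1 \<otimes> 1"
    and counit_mult: "\<epsilon> (g * h) = \<epsilon> g * \<epsilon> h"
    and counit_one: "\<epsilon> 1 = 1"
    and antipode_left: "tensor_lift (\<lambda>x y. S x * y) (\<Delta> h) = \<epsilon> h *\<^sub>C 1"
    and antipode_right: "tensor_lift (\<lambda>x y. x * S y) (\<Delta> h) = \<epsilon> h *\<^sub>C 1"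
begin

definition left_integral :: "('h \<Rightarrow> complex) \<Rightarrow> bool"
  where "left_integral l \<longleftrightarrow>
    clinear l \<and> (\<forall>h. tensor_lift (\<lambda>x y. l y *\<^sub>C x) (\<Delta> h) = l h *\<^sub>C 1)"

definition unital_subalgebra :: "'h set \<Rightarrow> bool"
  where "unital_subalgebra A \<longleftrightarrow>
    cvec.subspace A \<and> 1 \<in> A \<and> (\<forall>x\<in>A. \<forall>y\<in>A. x * y \<in> A)"

definition left_coideal_subalgebra :: "'h set \<Rightarrow> bool"
  where "left_coideal_subalgebra L \<longleftrightarrow>
    unital_subalgebra L \<and> \<Delta> ` L \<subseteq> tensor_space UNIV L"

definition hopf_subalgebra :: "'h set \<Rightarrow> bool"
  where "hopf_subalgebra K \<longleftrightarrow>
    unital_subalgebra K \<and> \<Delta> ` K \<subseteq> tensor_space K K \<and> S ` K \<subseteq> K"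

end

text \<open>
  The restriction to \<open>V \<times> V\<close> of the bilinear form \<open>(x, y) \<mapsto> l (x * y)\<close> has trivial left and
  right radicals; \<open>V\<close> need not be closed under multiplication.
\<close>

definition nondegenerate_on :: "('a::complex_algebra_1 \<Rightarrow> complex) \<Rightarrow> 'a set \<Rightarrow> bool"
  where "nondegenerate_on l V \<longleftrightarrow>
    (\<forall>x\<in>V. (\<forall>y\<in>V. l (x * y) = 0) \<longrightarrow> x = 0) \<and>
    (\<forall>y\<in>V. (\<forall>x\<in>V. l (x * y) = 0) \<longrightarrow> y = 0)"

end

theory Submission
  imports Defs "HOL-Computational_Algebra.Fundamental_Theorem_Algebra"
begin

text \<open>
  The crucial fact is the theorem of Larson and Radford: the antipode of a semisimple Hopf algebra
  over the complex numbers is an involution, and the integral \<open>l\<close> is, up to a scalar, the character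
  \<open>\<chi>\<close> of the regular representation. In particular \<open>l\<close> is symmetric and also a right integral.

  Given this, \<open>l\<close> is nondegenerate on every left coideal subalgebra \<open>L\<close>. All powers of an element \<open>x\<close>
  of the radical have trace zero, so \<open>x\<close> is nilpotent and \<open>\<epsilon>(x) = 0\<close>. But the radical is a left coideal,
  and a left coideal on which the counit vanishes is zero. For \<open>L + K\<close> let \<open>z\<close> be the element of \<open>K\<close> that
  represents the counit of \<open>K\<close> through \<open>l\<close>. The map \<open>h \<mapsto> l(h\<^sub>1 z) h\<^sub>2\<close> is the identity on \<open>K\<close>, preserves \<open>L\<close>
  and annihilates the radical of \<open>L + K\<close>; hence this radical is contained in \<open>L\<close>, where the form is
  nondegenerate (\<open>integral_nondegenerate_on_sum\<close>).

  For the theorem of Larson and Radford, normalize \<open>l\<close> and a two-sided integral \<open>\<Lambda>\<close> of \<open>H\<close> by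
  \<open>\<epsilon>(\<Lambda>) = l(\<Lambda>) = 1\<close>. Then \<open>S(h) = \<Lambda>\<^sub>1 l(h \<Lambda>\<^sub>2)\<close>, which yields the Nakayama relation
  \<open>l(z h) = l(h S\<^sup>2(z))\<close>, the trace formula that \<open>h \<mapsto> x S\<^sup>2(h)\<close> has trace \<open>l(x)\<close>, and Radford's formula
  \<open>x g = g S\<^sup>4(x)\<close> with a grouplike element \<open>g\<close>. As \<open>g\<close> has finite order, so has \<open>S\<^sup>2\<close>; and \<open>S\<^sup>2\<close> is inner,
  because \<open>H\<close> has the symmetric form \<open>\<chi>\<close>. On a matrix block, conjugation by \<open>u\<close> has trace
  \<open>tr(u) tr(u\<^sup>-\<^sup>1)\<close>, which is not negative in the case of finite order
  (\<open>trace_conjugation_nonneg\<close>). So \<open>l(1) = tr(S\<^sup>2)\<close> is not zero (\<open>integral_one_nonzero\<close>), \<open>g = 1\<close>, and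
  \<open>S\<^sup>4\<close> is the identity. Finally \<open>\<chi> / n\<close> with \<open>n = dim H\<close> is a convolution idempotent, and the trace of
  \<open>S\<^sup>2\<close> on the range of the corresponding operator is \<open>l(1) / n\<close>, an integer
  (\<open>integral_one_divisible\<close>). An involution on an \<open>n\<close>-dimensional space whose trace is a nonzero
  multiple of \<open>n\<close> is \<open>1\<close> or \<open>- 1\<close>, and \<open>S\<^sup>2(1) = 1\<close>.
\<close>

section \<open>Traces of operators on a finite-dimensional space\<close>

lemma clinearD:
  assumes "clinear f"
  shows "f (x + y) = f x + f y" and "f (c *\<^sub>C x) = c *\<^sub>C f x" and "f 0 = 0"
    and "f (x - y) = f x - f y" and "f (sum h A) = (\<Sum>a\<in>A. f (h a))"
proof -
  interpret f: Vector_Spaces.linear scaleC scaleC f by (fact assms)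
  show "f (x + y) = f x + f y" "f (c *\<^sub>C x) = c *\<^sub>C f x" "f 0 = 0" "f (x - y) = f x - f y"
    "f (sum h A) = (\<Sum>a\<in>A. f (h a))"
    by (simp_all add: f.add f.scale f.zero f.diff f.sum)
qed

lemma clinear_functional_scale: "clinear f \<Longrightarrow> f (c *\<^sub>C x) = c * f x" for f :: "_ \<Rightarrow> complex"
  by (simp add: clinearD(2) scaleC_complex_def)

text \<open>
  A functional that vanishes on the common kernel of finitely many functionals is a combination of
  them. The inductive step removes one functional \<open>\<phi> m\<close>, using a vector on which only \<open>\<phi> m\<close> is
  nonzero.
\<close>

lemma functional_eq_combination:
  fixes \<phi> :: "'i \<Rightarrow> 'a::complex_vector \<Rightarrow> complex"
  assumes "finite A" "\<And>a. a \<in> A \<Longrightarrow> clinear (\<phi> a)" "clinear \<psi>" "cvec.subspace V"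
    and "\<And>y. y \<in> V \<Longrightarrow> (\<And>a. a \<in> A \<Longrightarrow> \<phi> a y = 0) \<Longrightarrow> \<psi> y = 0"
  shows "\<exists>c. \<forall>y\<in>V. \<psi> y = (\<Sum>a\<in>A. c a * \<phi> a y)"
  using assms(1,2,3,5)
proof (induction A arbitrary: \<psi> rule: finite_induct)
  case empty
  then show ?case by simp
next
  case (insert m A)
  note lin = clinearD[OF \<open>clinear \<psi>\<close>] clinear_functional_scale[OF \<open>clinear \<psi>\<close>]
  have lin\<phi>: "clinear (\<phi> a)" if "a \<in> insert m A" for a using insert.prems(1) that .
  show ?case
  proof (cases "\<forall>y\<in>V. (\<forall>a\<in>A. \<phi> a y = 0) \<longrightarrow> \<phi> m y = 0")
    case True
    have "\<exists>c. \<forall>y\<in>V. \<psi> y = (\<Sum>a\<in>A. c a * \<phi> a y)"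
      using insert.prems True by (intro insert.IH) auto
    then obtain c where c: "\<forall>y\<in>V. \<psi> y = (\<Sum>a\<in>A. c a * \<phi> a y)" ..
    have "(\<Sum>a\<in>insert m A. (c(m := 0)) a * \<phi> a y) = (\<Sum>a\<in>A. c a * \<phi> a y)" for y
      using insert.hyps by (simp, intro sum.cong) auto
    with c show ?thesis by metis
  next
    case False
    then obtain v where v: "v \<in> V" "\<And>a. a \<in> A \<Longrightarrow> \<phi> a v = 0" "\<phi> m v \<noteq> 0" by auto
    define r where "r = \<psi> v / \<phi> m v"
    define \<psi>' where "\<psi>' = (\<lambda>y. \<psi> y - r * \<phi> m y)"
    note linm = clinearD[OF lin\<phi>[of m, simplified]] clinear_functional_scale[OF lin\<phi>[of m, simplified]]
    have "clinear \<psi>'"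
      by (auto simp: clinear_iff \<psi>'_def lin linm scaleC_complex_def algebra_simps)
    moreover have "\<psi>' y = 0" if y: "y \<in> V" "\<And>a. a \<in> A \<Longrightarrow> \<phi> a y = 0" for y
    proof -
      define w where "w = y - (\<phi> m y / \<phi> m v) *\<^sub>C v"
      have "w \<in> V" unfolding w_def
        using y v assms(4) by (intro cvec.subspace_diff cvec.subspace_scale) auto
      moreover have "\<phi> a w = 0" if "a \<in> insert m A" for a
        using that y v
        by (auto simp: w_def clinearD[OF lin\<phi>[OF that]] clinear_functional_scale[OF lin\<phi>[OF that]]
          linm scaleC_complex_def)
      ultimately have "\<psi> w = 0" using insert.prems(3) by blast
      then show ?thesis
        using v by (simp add: w_def lin \<psi>'_def r_def scaleC_complex_def)
    qed
    ultimately have "\<exists>c. \<forall>y\<in>V. \<psi>' y = (\<Sum>a\<in>A. c a * \<phi> a y)"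
      using insert.prems(1) by (intro insert.IH) auto
    then obtain c where c: "\<forall>y\<in>V. \<psi>' y = (\<Sum>a\<in>A. c a * \<phi> a y)" ..
    have "(\<Sum>a\<in>insert m A. (c(m := r)) a * \<phi> a y) = r * \<phi> m y + (\<Sum>a\<in>A. c a * \<phi> a y)" for y
      using insert.hyps by (simp, intro sum.cong) auto
    with c have "\<forall>y\<in>V. \<psi> y = (\<Sum>a\<in>insert m A. (c(m := r)) a * \<phi> a y)"
      by (auto simp: \<psi>'_def algebra_simps)
    then show ?thesis by blast
  qed
qed

locale fin_dim_space =
  fixes Bas :: "'a::complex_vector set"
  assumes finite_Bas: "finite Bas"
    and independent_Bas: "cvec.independent Bas"
    and span_Bas: "cvec.span Bas = UNIV"

sublocale fin_dim_space \<subseteq> fd: finite_dimensional_vector_space scaleC Bas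
  by unfold_locales (fact finite_Bas independent_Bas span_Bas)+

lemma fin_dim_imp_fin_dim_space:
  assumes "fin_dim TYPE('a::complex_vector)"
  obtains Bas :: "'a::complex_vector set" where "fin_dim_space Bas"
proof -
  obtain A :: "'a set" where A: "finite A" "cvec.span A = UNIV"
    using assms by (auto simp: fin_dim_def)
  obtain Bas where Bas: "Bas \<subseteq> A" "cvec.independent Bas" "A \<subseteq> cvec.span Bas"
    using cvec.maximal_independent_subset[of A] by blast
  then have "cvec.span Bas = UNIV"
    using A(2) cvec.span_mono[of A "cvec.span Bas"] by (auto simp: cvec.span_span)
  with Bas A show ?thesis
    by (intro that[of Bas]) (auto simp: fin_dim_space_def intro: finite_subset)
qed

context fin_dim_space
begin

definition coord :: "'a \<Rightarrow> 'a \<Rightarrow> complex" where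
  "coord b v = cvec.representation Bas v b"

definition trace :: "('a \<Rightarrow> 'a) \<Rightarrow> complex" where
  "trace f = (\<Sum>b\<in>Bas. coord b (f b))"

lemma clinear_coord: "clinear (coord b)"
  by (simp add: clinear_iff coord_def cvec.representation_add cvec.representation_scale
    independent_Bas span_Bas scaleC_complex_def)

lemma sum_coord: "(\<Sum>b\<in>Bas. coord b v *\<^sub>C b) = v"
  unfolding coord_def
  by (rule cvec.sum_representation_eq) (auto simp: independent_Bas span_Bas finite_Bas)

lemma functionals_separate:
  assumes "\<And>p :: 'a \<Rightarrow> complex. clinear p \<Longrightarrow> p x = p y"
  shows "x = y"
proof -
  have "(\<Sum>b\<in>Bas. coord b x *\<^sub>C b) = (\<Sum>b\<in>Bas. coord b y *\<^sub>C b)"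
    by (intro sum.cong refl arg_cong[where f = "\<lambda>c. c *\<^sub>C _"] assms clinear_coord)
  then show ?thesis by (simp only: sum_coord)
qed

lemma trace_rank_one:
  assumes "clinear \<phi>"
  shows "trace (\<lambda>h. \<phi> h *\<^sub>C v) = \<phi> v"
proof -
  have "trace (\<lambda>h. \<phi> h *\<^sub>C v) = (\<Sum>b\<in>Bas. \<phi> (coord b v *\<^sub>C b))"
    by (simp add: trace_def clinear_functional_scale[OF clinear_coord]
      clinear_functional_scale[OF assms] mult.commute)
  also have "\<dots> = \<phi> v"
    by (simp flip: clinearD(5)[OF assms] add: sum_coord)
  finally show ?thesis .
qed

lemma trace_sum: "trace (\<lambda>h. \<Sum>i\<in>I. f i h) = (\<Sum>i\<in>I. trace (f i))"
  by (simp add: trace_def clinearD(5)[OF clinear_coord] sum.swap[of _ Bas I])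

lemma trace_zero: "trace (\<lambda>h. 0) = 0"
  by (simp add: trace_def clinearD[OF clinear_coord])

lemma trace_add: "trace (\<lambda>h. f h + g h) = trace f + trace g"
  by (simp add: trace_def clinearD[OF clinear_coord] sum.distrib)

lemma trace_diff: "trace (\<lambda>h. f h - g h) = trace f - trace g"
  by (simp add: trace_def clinearD[OF clinear_coord] sum_subtractf)

lemma trace_scale: "trace (\<lambda>h. c *\<^sub>C f h) = c * trace f"
  by (simp add: trace_def clinear_functional_scale[OF clinear_coord] sum_distrib_left)

text \<open>
  Writing one factor as a sum of rank-one operators reduces the cyclicity of the trace to
  \<open>trace_rank_one\<close>.
\<close>

lemma trace_commute:
  assumes "clinear f" "clinear g"
  shows "trace (\<lambda>h. f (g h)) = trace (\<lambda>h. g (f h))"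
proof -
  have "f (g h) = (\<Sum>b\<in>Bas. coord b (g h) *\<^sub>C f b)" for h
    by (simp flip: clinearD(5)[OF assms(1)] clinearD(2)[OF assms(1)] add: sum_coord)
  then have "trace (\<lambda>h. f (g h)) = (\<Sum>b\<in>Bas. trace (\<lambda>h. coord b (g h) *\<^sub>C f b))"
    by (simp add: trace_sum)
  also have "\<dots> = (\<Sum>b\<in>Bas. coord b (g (f b)))"
    using clinear_coord assms(2)
    by (intro sum.cong refl trace_rank_one) (auto simp: clinear_iff)
  finally show ?thesis by (simp add: trace_def)
qed

text \<open>
  Expand \<open>P\<close> in the coordinates of a basis of its range, on which \<open>P\<close> is the identity. The integrality
  and positivity statements below all come from this.
\<close>

lemma trace_idempotent:
  assumes "clinear P" "\<And>h. P (P h) = P h"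
  shows "trace P = of_nat (cvec.dim (range P))"
proof -
  obtain C where C: "C \<subseteq> range P" "cvec.independent C" "range P \<subseteq> cvec.span C"
      "card C = cvec.dim (range P)"
    using cvec.basis_exists by blast
  then have fin: "finite C" by (auto intro: fd.finiteI_independent)
  define r where "r c h = cvec.representation C (P h) c" for c h
  have inC: "P h \<in> cvec.span C" for h using C by blast
  have "clinear (r c)" for c
    by (simp add: clinear_iff r_def clinearD[OF assms(1)] cvec.representation_add
      cvec.representation_scale C inC scaleC_complex_def)
  moreover have "P h = (\<Sum>c\<in>C. r c h *\<^sub>C c)" for h
    unfolding r_def by (rule cvec.sum_representation_eq[symmetric]) (use C fin inC in auto)
  then have "trace P = (\<Sum>c\<in>C. trace (\<lambda>h. r c h *\<^sub>C c))"
    unfolding trace_sum[symmetric] by metis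
  ultimately have "trace P = (\<Sum>c\<in>C. r c c)"
    by (simp add: trace_rank_one)
  also have "\<dots> = (\<Sum>c\<in>C. 1)"
  proof (rule sum.cong)
    fix c assume c: "c \<in> C"
    then have "P c = c" using C assms(2) by auto
    then show "r c c = 1" by (simp add: r_def cvec.representation_basis C c)
  qed simp
  finally show ?thesis using C by simp
qed

lemma trace_idempotent_eq_0:
  assumes "clinear P" "\<And>h. P (P h) = P h" "trace P = 0"
  shows "P h = 0"
proof -
  have "cvec.dim (range P) = 0" using trace_idempotent[OF assms(1,2)] assms(3) by simp
  then show ?thesis by auto
qed

text \<open>
  A polynomial relation for \<open>T\<close> at a vector splits off a linear factor at a complex root; either
  the cofactor yields an eigenvector or it is a relation of smaller degree.
\<close>

lemma eigenvector_of_annihilating_polynomial: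
  fixes p :: "complex poly" and T :: "'a \<Rightarrow> 'a"
  assumes T: "clinear T" and M: "cvec.subspace M" "\<And>v. v \<in> M \<Longrightarrow> T v \<in> M"
    and "v \<in> M" "v \<noteq> 0" "p \<noteq> 0" "degree p \<le> N"
    and "(\<Sum>i\<le>N. coeff p i *\<^sub>C (T ^^ i) v) = 0"
  shows "\<exists>c w. w \<in> M \<and> w \<noteq> 0 \<and> T w = c *\<^sub>C w"
  using assms(6-)
proof (induction N arbitrary: p)
  case 0
  then have "coeff p 0 \<noteq> 0" by (metis le_zero_eq leading_coeff_0_iff)
  with 0 \<open>v \<noteq> 0\<close> show ?case by simp
next
  case (Suc N)
  show ?case
  proof (cases "degree p = 0")
    case True
    then have "coeff p 0 \<noteq> 0" "\<And>i. i > 0 \<Longrightarrow> coeff p i = 0"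
      using Suc.prems(1) leading_coeff_0_iff[of p] by (auto simp: coeff_eq_0)
    then have "(\<Sum>i\<le>Suc N. coeff p i *\<^sub>C (T ^^ i) v) = coeff p 0 *\<^sub>C v"
      by (subst sum.atMost_Suc_shift) simp
    with \<open>coeff p 0 \<noteq> 0\<close> Suc.prems(3) \<open>v \<noteq> 0\<close> show ?thesis by simp
  next
    case False
    then have "\<not> constant (poly p)" by (simp add: constant_degree)
    then obtain z where "poly p z = 0"
      using fundamental_theorem_of_algebra by blast
    then obtain r where r: "p = [:- z, 1:] * r" by (auto simp: poly_eq_0_iff_dvd)
    with Suc.prems have r0: "r \<noteq> 0" by auto
    then have "degree p = Suc (degree r)"
      unfolding r by (subst degree_mult_eq) auto
    with Suc.prems have dr: "degree r \<le> N" by simp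
    define w where "w = (\<Sum>i\<le>N. coeff r i *\<^sub>C (T ^^ i) v)"
    have Ti: "(T ^^ i) v \<in> M" for i
      by (induction i) (auto simp: \<open>v \<in> M\<close> M)
    then have wM: "w \<in> M" unfolding w_def
      using M(1) by (intro cvec.subspace_sum cvec.subspace_scale) auto
    have p_coeff: "coeff p i = coeff (pCons 0 r) i - z * coeff r i" for i
      by (simp add: r)
    have "(\<Sum>i\<le>Suc N. coeff p i *\<^sub>C (T ^^ i) v) =
        (\<Sum>i\<le>Suc N. coeff (pCons 0 r) i *\<^sub>C (T ^^ i) v)
          - z *\<^sub>C (\<Sum>i\<le>Suc N. coeff r i *\<^sub>C (T ^^ i) v)"
      by (simp only: p_coeff cvec.scale_left_diff_distrib sum_subtractf cvec.scale_sum_right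
        scaleC_scaleC)
    also have "(\<Sum>i\<le>Suc N. coeff (pCons 0 r) i *\<^sub>C (T ^^ i) v) = T w"
      by (subst sum.atMost_Suc_shift) (simp add: w_def clinearD[OF T])
    also have "(\<Sum>i\<le>Suc N. coeff r i *\<^sub>C (T ^^ i) v) = w"
      using dr by (simp add: w_def coeff_eq_0)
    finally have "T w = z *\<^sub>C w" using Suc.prems(3) by simp
    then show ?thesis
      using wM Suc.IH[OF r0 dr] w_def by metis
  qed
qed

lemma exists_eigenvector:
  fixes T :: "'a \<Rightarrow> 'a"
  assumes T: "clinear T" and M: "cvec.subspace M" "\<And>v. v \<in> M \<Longrightarrow> T v \<in> M"
    and v: "v \<in> M" "v \<noteq> 0"
  obtains c w where "w \<in> M" "w \<noteq> 0" "T w = c *\<^sub>C w"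
proof -
  define N where "N = card Bas"
  define s where "s i = (T ^^ i) v" for i
  have "\<exists>u. (\<exists>i\<le>N. u i \<noteq> 0) \<and> (\<Sum>i\<le>N. u i *\<^sub>C s i) = 0"
  proof (cases "inj_on s {..N}")
    case True
    have "\<not> cvec.independent (s ` {..N})"
    proof
      assume "cvec.independent (s ` {..N})"
      then have "card (s ` {..N}) \<le> card Bas"
        using fd.independent_card_le_dim[of "s ` {..N}" UNIV] by simp
      with True show False by (simp add: card_image N_def)
    qed
    then obtain u where u: "(\<Sum>x\<in>s ` {..N}. u x *\<^sub>C x) = 0" "\<exists>x\<in>s ` {..N}. u x \<noteq> 0"
      by (auto simp: cvec.dependent_finite)
    then have "(\<Sum>i\<le>N. u (s i) *\<^sub>C s i) = 0"
      using sum.reindex[OF True, of "\<lambda>x. u x *\<^sub>C x"] by simp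
    with u show ?thesis by (intro exI[of _ "u \<circ> s"]) auto
  next
    case False
    then obtain i j where ij: "i \<le> N" "j \<le> N" "i \<noteq> j" "s i = s j"
      by (auto simp: inj_on_def)
    define u :: "nat \<Rightarrow> complex" where "u k = (if k = i then 1 else 0) - (if k = j then 1 else 0)" for k
    have "(\<Sum>k\<le>N. u k *\<^sub>C s k) =
        (\<Sum>k\<le>N. (if k = i then s k else 0) - (if k = j then s k else 0))"
      using ij(3) by (intro sum.cong) (auto simp: u_def scaleC_one)
    also have "\<dots> = (\<Sum>k\<le>N. if k = i then s k else 0) - (\<Sum>k\<le>N. if k = j then s k else 0)"
      by (rule sum_subtractf)
    also have "\<dots> = 0" using ij by simp
    finally show ?thesis using ij by (intro exI[of _ u]) (auto simp: u_def)
  qed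
  then obtain u i0 where u: "i0 \<le> N" "u i0 \<noteq> 0" "(\<Sum>i\<le>N. u i *\<^sub>C s i) = 0" by blast
  define p where "p = (\<Sum>i\<le>N. monom (u i) i)"
  have cp: "coeff p i = (if i \<le> N then u i else 0)" for i
    by (simp add: p_def coeff_sum coeff_monom)
  have "p \<noteq> 0" using u cp[of i0] by auto
  moreover have "degree p \<le> N" by (intro degree_le) (simp add: cp)
  moreover have "(\<Sum>i\<le>N. coeff p i *\<^sub>C (T ^^ i) v) = 0"
    using u(3) by (simp add: cp s_def)
  ultimately show ?thesis
    using eigenvector_of_annihilating_polynomial[OF T M v] that by blast
qed

end

section \<open>Idempotents in finite-dimensional algebras\<close>

lemma clinear_intros:
  fixes f :: "'b::complex_vector \<Rightarrow> 'a::complex_algebra_1"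
    and h k :: "'b \<Rightarrow> 'c::complex_vector"
  shows "clinear (\<lambda>x. x)"
    and "clinear f \<Longrightarrow> clinear (\<lambda>x. f x * a)"
    and "clinear f \<Longrightarrow> clinear (\<lambda>x. a * f x)"
    and "clinear g \<Longrightarrow> clinear (\<lambda>x. g x *\<^sub>C v)"
    and "clinear h \<Longrightarrow> clinear (\<lambda>x. c *\<^sub>C h x)"
    and "clinear h \<Longrightarrow> clinear k \<Longrightarrow> clinear (\<lambda>x. h x + k x)"
    and "clinear h \<Longrightarrow> clinear k \<Longrightarrow> clinear (\<lambda>x. h x - k x)"
    and "(\<And>i. i \<in> I \<Longrightarrow> clinear (s i)) \<Longrightarrow> clinear (\<lambda>x. \<Sum>i\<in>I. s i x)"
  by (auto simp: clinear_iff algebra_simps mult_scaleC_left mult_scaleC_right scaleC_add_left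
      scaleC_add_right scaleC_scaleC scaleC_complex_def cvec.scale_right_diff_distrib
      sum.distrib cvec.scale_sum_right)

lemma clinear_compose: "clinear f \<Longrightarrow> clinear g \<Longrightarrow> clinear (\<lambda>x. f (g x))"
  by (simp add: clinear_iff)

lemma span_image_clinear: "clinear f \<Longrightarrow> cvec.span (f ` A) = f ` cvec.span A"
proof -
  assume "clinear f"
  then interpret f: Vector_Spaces.linear scaleC scaleC f .
  show ?thesis by (rule f.span_image)
qed

locale fin_dim_algebra = fin_dim_space Bas for Bas :: "'a::complex_algebra_1 set"
begin

text \<open>
  In the form used here, the kernel lemma for functionals says that a functional on \<open>W\<close> killed by the
  right radical of the pairing \<open>(k, y) \<mapsto> l(k y)\<close> of \<open>V\<close> and \<open>W\<close> is represented by an element of \<open>V\<close>.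
\<close>

lemma functional_representation:
  assumes l: "clinear l" and V: "cvec.subspace (V :: 'a set)" and W: "cvec.subspace W"
    and \<phi>: "clinear \<phi>" "\<And>y. y \<in> W \<Longrightarrow> (\<And>k. k \<in> V \<Longrightarrow> l (k * y) = 0) \<Longrightarrow> \<phi> y = (0 :: complex)"
  obtains k where "k \<in> V" "\<And>y. y \<in> W \<Longrightarrow> \<phi> y = l (k * y)"
proof -
  obtain C where C: "C \<subseteq> V" "cvec.independent C" "V \<subseteq> cvec.span C"
    using cvec.basis_exists[of V] by metis
  then have fin: "finite C" by (auto intro: fd.finiteI_independent)
  have lin: "clinear (\<lambda>y. l (a * y))" "clinear (\<lambda>a. l (a * y))" for a y
    by (intro clinear_compose[OF l] clinear_intros)+
  have "\<exists>c. \<forall>y\<in>W. \<phi> y = (\<Sum>a\<in>C. c a * l (a * y))"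
  proof (rule functional_eq_combination[OF fin lin(1) \<phi>(1) W])
    fix y assume y: "y \<in> W" "\<And>a. a \<in> C \<Longrightarrow> l (a * y) = 0"
    have "cvec.subspace {k. l (k * y) = 0}"
      by (auto simp: cvec.subspace_def distrib_right mult_scaleC_left clinearD[OF l])
    then have "cvec.span C \<subseteq> {k. l (k * y) = 0}"
      using y by (intro cvec.span_minimal) auto
    with C(3) have "l (k * y) = 0" if "k \<in> V" for k using that by blast
    then show "\<phi> y = 0" by (rule \<phi>(2)[OF y(1)])
  qed
  then obtain c where c: "\<forall>y\<in>W. \<phi> y = (\<Sum>a\<in>C. c a * l (a * y))" ..
  show ?thesis
  proof (rule that)
    show "(\<Sum>a\<in>C. c a *\<^sub>C a) \<in> V"
      using C(1) V by (intro cvec.subspace_sum cvec.subspace_scale) auto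
    show "\<phi> y = l ((\<Sum>a\<in>C. c a *\<^sub>C a) * y)" if "y \<in> W" for y
      using c that
      by (simp add: clinearD(5)[OF lin(2)] clinear_functional_scale[OF lin(2)])
  qed
qed

definition regular_character :: "'a \<Rightarrow> complex" where
  "regular_character x = trace (\<lambda>h. x * h)"

lemma clinear_regular_character: "clinear regular_character"
  by (auto simp: clinear_iff regular_character_def distrib_right trace_add mult_scaleC_left
      trace_scale scaleC_complex_def)

lemma regular_character_commute: "regular_character (x * y) = regular_character (y * x)"
  unfolding regular_character_def mult.assoc
  by (rule trace_commute) (intro clinear_intros)+

lemma regular_character_idempotent:
  assumes "e * e = e"
  shows "regular_character e = 0 \<Longrightarrow> e = 0"
proof -
  assume "regular_character e = 0"
  then have "e * 1 = 0"
    unfolding regular_character_def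
    by (rule trace_idempotent_eq_0[rotated 2])
      (auto intro!: clinear_intros simp: assms simp flip: mult.assoc)
  then show "e = 0" by simp
qed

text \<open>
  The spans of \<open>x\<^sup>a, x\<^sup>a\<^sup>+\<^sup>1, \<dots>\<close> form a descending chain, which becomes stationary. From then on the span
  \<open>W a\<close> equals \<open>W a x\<^sup>a\<close>, and an element \<open>y\<close> with \<open>x\<^sup>a = y x\<^sup>a\<close> is a left unit of \<open>W a\<close>. The functional
  \<open>\<phi>\<close> witnesses that \<open>x\<close> is not nilpotent, so that \<open>y\<close> is not zero.
\<close>

lemma exists_idempotent_in_powers:
  fixes x :: 'a
  assumes \<phi>: "\<And>x y. \<phi> (x * y) = \<phi> x * \<phi> y" "\<phi> 1 = (1::complex)" "\<phi> 0 = 0" and x: "\<phi> x \<noteq> 0"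
  obtains e where "e \<in> cvec.span ((\<lambda>i. x ^ i) ` {1..})" "e * e = e" "e \<noteq> 0"
proof -
  define W where "W n = cvec.span ((\<lambda>i. x ^ i) ` {n..})" for n
  have sub: "cvec.subspace (W n)" for n by (simp add: W_def cvec.subspace_span)
  have anti: "W n \<subseteq> W m" if "m \<le> n" for m n
    unfolding W_def by (rule cvec.span_mono) (use that in auto)
  obtain a where a: "1 \<le> a" "\<And>b. 1 \<le> b \<Longrightarrow> cvec.dim (W a) \<le> cvec.dim (W b)"
    using ex_has_least_nat[of "\<lambda>a. 1 \<le> a" 1 "\<lambda>a. cvec.dim (W a)"] by auto
  have eq: "W (a + a) = W a"
    using a by (intro fd.subspace_dim_equal sub anti) auto
  have img: "{a + a..} = (\<lambda>i. a + i) ` {a..}" by simp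
  have pow: "x ^ (a + i) = x ^ i * x ^ a" for i by (metis add.commute power_add)
  have "W (a + a) = cvec.span ((\<lambda>w. w * x ^ a) ` (\<lambda>i. x ^ i) ` {a..})"
    "W (a + a) = cvec.span ((\<lambda>w. x ^ a * w) ` (\<lambda>i. x ^ i) ` {a..})"
    unfolding W_def img image_image by (simp_all only: pow) (simp only: power_add flip: pow)
  then have "W (a + a) = (\<lambda>w. w * x ^ a) ` W a" "W (a + a) = (\<lambda>w. x ^ a * w) ` W a"
    by (simp_all only: W_def span_image_clinear[OF clinear_intros(2)[OF clinear_intros(1)]]
        span_image_clinear[OF clinear_intros(3)[OF clinear_intros(1)]])
  then have right: "\<exists>y\<in>W a. z = y * x ^ a" and left: "\<exists>w\<in>W a. z = x ^ a * w" if "z \<in> W a" for z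
    using that eq by auto
  have "x ^ a \<in> W a" unfolding W_def by (rule cvec.span_base) auto
  from right[OF this] obtain y where y: "y \<in> W a" "x ^ a = y * x ^ a" by blast
  have "y * y = y"
    using left[OF y(1)] y(2) by (metis mult.assoc)
  moreover have "\<phi> (x ^ n) \<noteq> 0" for n
    by (induction n) (auto simp: \<phi> x)
  with y(2) have "y \<noteq> 0" using \<phi>(3) by (metis mult_zero_left)
  moreover have "y \<in> W 1" using anti[OF a(1)] y(1) by blast
  ultimately show ?thesis using that[of y] by (simp add: W_def)
qed

end

section \<open>Semisimple algebras\<close>

locale semisimple_fin_dim_algebra = fin_dim_algebra Bas for Bas :: "'a::complex_algebra_1 set" +
  assumes semisimple: "semisimple_algebra TYPE('a)"
begin

lemma left_ideal_principal: "left_ideal (range (\<lambda>h. h * (x::'a)))"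
proof -
  have "cvec.subspace (range (\<lambda>h. h * x))"
    using span_image_clinear[of "\<lambda>h. h * x" UNIV] cvec.subspace_span[of "range (\<lambda>h. h * x)"]
    by (simp add: clinear_intros)
  then show ?thesis
    unfolding left_ideal_def by (auto simp flip: mult.assoc)
qed

lemma left_ideal_sum:
  "left_ideal I \<Longrightarrow> left_ideal J \<Longrightarrow> left_ideal {x + y | x y. x \<in> I \<and> (y::'a) \<in> J}"
  unfolding left_ideal_def by (auto intro!: cvec.subspace_sums simp: distrib_left) blast

lemma left_ideal_Int: "left_ideal I \<Longrightarrow> left_ideal J \<Longrightarrow> left_ideal (I \<inter> (J::'a set))"
  unfolding left_ideal_def by (auto intro: cvec.subspace_inter)

text \<open>
  A left ideal \<open>J\<close> of maximal dimension among those meeting \<open>I\<close> trivially works: a simple left ideal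
  outside \<open>I + J\<close> could be added to \<open>J\<close>.
\<close>

lemma left_ideal_complement:
  assumes I: "left_ideal (I :: 'a set)"
  obtains J where "left_ideal J" "I \<inter> J = {0}" "\<And>z. \<exists>x\<in>I. \<exists>y\<in>J. z = x + y"
proof -
  let ?P = "\<lambda>J. left_ideal J \<and> I \<inter> J = {0}"
  have "?P {0}" using I by (auto simp: left_ideal_def cvec.subspace_0)
  then obtain J where J: "left_ideal J" "I \<inter> J = {0}"
      and max: "\<And>J'. left_ideal J' \<Longrightarrow> I \<inter> J' = {0} \<Longrightarrow> cvec.dim J' \<le> cvec.dim J"
    using ex_has_greatest_nat[of ?P "{0}" cvec.dim "Suc (card Bas)"] fd.dim_subset_UNIV
    by (auto simp: fd.dimension_def less_Suc_eq_le)
  define N where "N = {x + y | x y. x \<in> I \<and> y \<in> J}"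
  have N: "left_ideal N" unfolding N_def by (rule left_ideal_sum[OF I J(1)])
  have sub: "cvec.subspace I" "cvec.subspace J" "cvec.subspace N"
    using I J N by (auto simp: left_ideal_def)
  have "M \<subseteq> N" if M: "simple_left_ideal M" for M
  proof (rule ccontr)
    assume "\<not> M \<subseteq> N"
    have M': "left_ideal M" "cvec.subspace M" using M by (auto simp: simple_left_ideal_def left_ideal_def)
    have "left_ideal (M \<inter> N)" using M' N by (intro left_ideal_Int)
    with M \<open>\<not> M \<subseteq> N\<close> have MN: "M \<inter> N = {0}" by (auto simp: simple_left_ideal_def)
    define J' where "J' = {x + y | x y. x \<in> J \<and> y \<in> M}"
    have J': "left_ideal J'" unfolding J'_def by (rule left_ideal_sum[OF J(1) M'(1)])
    have "I \<inter> J' \<subseteq> {0}"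
    proof
      fix z assume "z \<in> I \<inter> J'"
      then obtain j m where z: "z \<in> I" "j \<in> J" "m \<in> M" "z = j + m" by (auto simp: J'_def)
      have "m = z + (- j)" using z by simp
      moreover have "- j \<in> J" using z sub by (simp add: cvec.subspace_neg)
      ultimately have "m \<in> N" unfolding N_def using z by blast
      with z MN have "m = 0" by auto
      with z J show "z \<in> {0}" by auto
    qed
    moreover have "0 \<in> I \<inter> J'"
      using I J' by (auto simp: left_ideal_def cvec.subspace_0)
    ultimately have "cvec.dim J' \<le> cvec.dim J" using J' by (intro max) auto
    moreover have "J \<subseteq> J'" unfolding J'_def using cvec.subspace_0[OF M'(2)] by force
    ultimately have "J = J'"
      using sub J' by (intro fd.subspace_dim_equal) (auto simp: left_ideal_def)
    moreover have "M \<subseteq> J'" unfolding J'_def using cvec.subspace_0[OF sub(2)] by force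
    moreover have "J \<subseteq> N" unfolding N_def using cvec.subspace_0[OF sub(1)] by force
    ultimately show False using \<open>\<not> M \<subseteq> N\<close> by blast
  qed
  then have "cvec.span (\<Union>{I :: 'a set. simple_left_ideal I}) \<subseteq> N"
    by (intro cvec.span_minimal sub) auto
  then have "z \<in> N" for z
    using semisimple unfolding semisimple_algebra_def by auto
  then show ?thesis using J that[of J] unfolding N_def by blast
qed

text \<open>
  Decompose \<open>1\<close> along a complement of \<open>I\<close>; the component in \<open>I\<close> generates \<open>I\<close>.
\<close>

lemma left_ideal_right_unit:
  assumes I: "left_ideal (I :: 'a set)"
  obtains e where "e \<in> I" "\<And>x. x \<in> I \<Longrightarrow> x * e = x"
proof -
  obtain J where J: "left_ideal J" "I \<inter> J = {0}" "\<And>z. \<exists>x\<in>I. \<exists>y\<in>J. z = x + y"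
    using left_ideal_complement[OF I] by metis
  from J(3) obtain e f where ef: "e \<in> I" "f \<in> J" "1 = e + f" by blast
  have "x * e = x" if "x \<in> I" for x
  proof -
    have "x * f = x - x * e" using ef(3) by (metis add_diff_cancel_left' distrib_left mult.right_neutral)
    moreover have "x * f \<in> J" using J(1) ef by (auto simp: left_ideal_def)
    moreover have "x - x * e \<in> I" using I that ef by (auto simp: left_ideal_def intro: cvec.subspace_diff)
    ultimately have "x - x * e = 0" using J(2) by (metis IntI singletonD)
    then show ?thesis by simp
  qed
  with ef that show ?thesis by blast
qed

text \<open>
  A nonzero left ideal contains a nonzero idempotent, whose regular character is a positive
  integer; so no nonzero left ideal lies in the radical of the trace form.
\<close>

lemma regular_character_nondegenerate:
  assumes "\<And>y. regular_character (y * x) = 0"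
  shows "x = 0"
proof -
  obtain e where e: "e \<in> range (\<lambda>h. h * x)" "\<And>z. z \<in> range (\<lambda>h. h * x) \<Longrightarrow> z * e = z"
    using left_ideal_right_unit[OF left_ideal_principal[of x]] by blast
  have "e = 0" using e assms by (intro regular_character_idempotent) auto
  moreover have "1 * x * e = 1 * x" using e(2) by blast
  ultimately show ?thesis by simp
qed

definition two_sided_ideal :: "'a set \<Rightarrow> bool" where
  "two_sided_ideal J \<longleftrightarrow> cvec.subspace J \<and> (\<forall>a. \<forall>x\<in>J. a * x \<in> J \<and> x * a \<in> J)"

lemma two_sided_ideal_central_idempotent:
  assumes J: "two_sided_ideal J"
  obtains e where "e \<in> J" "\<And>x. x \<in> J \<Longrightarrow> x * e = x" "\<And>h. e * h = h * e"
proof -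
  have "left_ideal J" using J by (auto simp: two_sided_ideal_def left_ideal_def)
  then obtain e where e: "e \<in> J" "\<And>x. x \<in> J \<Longrightarrow> x * e = x" using left_ideal_right_unit by blast
  \<comment> \<open>The defect of \<open>e\<close> as a left unit generates a left ideal of square zero.\<close>
  have left: "e * x = x" if x: "x \<in> J" for x
  proof -
    define z where "z = x - e * x"
    have z: "z \<in> J" "\<And>y. y \<in> J \<Longrightarrow> y * z = 0"
      using J x e by (auto simp: z_def two_sided_ideal_def right_diff_distrib e(2)
          intro: cvec.subspace_diff simp flip: mult.assoc)
    obtain f where f: "f \<in> range (\<lambda>h. h * z)" "\<And>w. w \<in> range (\<lambda>h. h * z) \<Longrightarrow> w * f = w"
      using left_ideal_right_unit[OF left_ideal_principal[of z]] by blast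
    then obtain h where h: "f = h * z" by auto
    have "1 * z * f = 1 * z" using f(2) by blast
    then have "z = z * (h * z)" by (simp add: h)
    also have "\<dots> = 0"
      using z J by (simp add: two_sided_ideal_def flip: mult.assoc)
    finally show ?thesis by (simp add: z_def)
  qed
  have "e * h = h * e" for h
  proof -
    have "h * e \<in> J" "e * h \<in> J" using J e by (auto simp: two_sided_ideal_def)
    then show ?thesis using left[of "h * e"] e(2)[of "e * h"] by (simp add: mult.assoc)
  qed
  with e that show ?thesis by blast
qed

text \<open>
  Minimal left ideals are generated by idempotents \<open>q\<close> with scalar corner \<open>q A q\<close>: right
  multiplication by an element of the corner has an eigenvector, and its eigenspace is a left
  ideal, hence everything.
\<close>

lemma exists_primitive_idempotent:
  assumes I: "left_ideal I" "I \<noteq> {0 :: 'a}"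
  obtains q where "q \<in> I" "q \<noteq> 0" "q * q = q" "\<And>x. \<exists>c. q * x * q = c *\<^sub>C q"
proof -
  let ?P = "\<lambda>M. left_ideal M \<and> M \<noteq> {0} \<and> M \<subseteq> I"
  obtain M where M: "left_ideal M" "M \<noteq> {0}" "M \<subseteq> I"
      and min: "\<And>M'. ?P M' \<Longrightarrow> cvec.dim M \<le> cvec.dim M'"
    using ex_has_least_nat[of ?P I cvec.dim] I by auto
  have sub: "cvec.subspace M" using M by (simp add: left_ideal_def)
  obtain q where q: "q \<in> M" "\<And>x. x \<in> M \<Longrightarrow> x * q = x" using left_ideal_right_unit[OF M(1)] by blast
  have "q \<noteq> 0" using M(2) q(2) cvec.subspace_0[OF sub] by force
  have "\<exists>c. q * x * q = c *\<^sub>C q" for x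
  proof -
    define y where "y = q * x * q"
    have yM: "v * y \<in> M" for v
      using q M by (auto simp: y_def left_ideal_def simp flip: mult.assoc)
    obtain c w where w: "w \<in> M" "w \<noteq> 0" "w * y = c *\<^sub>C w"
      by (rule exists_eigenvector[of "\<lambda>v. v * y" M q])
        (auto intro!: clinear_intros simp: sub yM q \<open>q \<noteq> 0\<close>)
    define M' where "M' = {m \<in> M. m * y = c *\<^sub>C m}"
    have "left_ideal M'"
      using M(1) unfolding M'_def left_ideal_def cvec.subspace_def
      by (auto simp: distrib_right scaleC_add_right mult_scaleC_left mult_scaleC_right mult.assoc
          scaleC_scaleC mult.commute)
    moreover have "M' \<noteq> {0}" "M' \<subseteq> M" using w by (auto simp: M'_def)
    ultimately have "M' = M"
      using M(3) sub by (intro fd.subspace_dim_equal min) (auto simp: left_ideal_def)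
    with q have "q * y = c *\<^sub>C q" by (auto simp: M'_def)
    moreover have "q * y = y" using q by (simp add: y_def flip: mult.assoc)
    ultimately show ?thesis unfolding y_def by metis
  qed
  with q M \<open>q \<noteq> 0\<close> that show ?thesis by blast
qed

end

section \<open>The trace of an inner automorphism\<close>

text \<open>
  The spectral projections \<open>a k\<close> of an element \<open>w\<close> of finite order are idempotents, so \<open>f\<close> is real on
  them. Now \<open>f w\<close> is the sum of the terms \<open>\<omega>\<^sup>k f (a k)\<close>, and \<open>f\<close> at the inverse of \<open>w\<close> is the sum of their conjugates.
\<close>

lemma functional_power_conjugate:
  fixes f :: "'a::complex_algebra_1 \<Rightarrow> complex"
  assumes f: "clinear f" "\<And>e. e * e = e \<Longrightarrow> f e \<in> \<real>"
    and N: "N > 0" "w ^ N = 1"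
  shows "f (w ^ (N - 1)) = cnj (f w)"
proof -
  define \<omega> where "\<omega> = cis (2 * pi / real N)"
  have \<omega>: "\<omega> * cnj \<omega> = 1" "\<omega> ^ N = 1" "cnj \<omega> ^ N = 1"
    using N by (simp_all add: \<omega>_def cis_mult DeMoivre flip: complex_cnj_power)
    (simp_all add: cis_cnj cis_mult)
  have pw: "cnj \<omega> ^ n * \<omega> ^ n = 1" "\<omega> ^ n * cnj \<omega> ^ n = 1" for n
    using \<omega>(1) by (simp_all add: mult.commute[of "cnj \<omega>" \<omega>] flip: power_mult_distrib)
  define s where "s k m = cnj \<omega> ^ (k * m) *\<^sub>C w ^ m" for k m
  define a where "a k = (1 / of_nat N) *\<^sub>C (\<Sum>m<N. s k m)" for k
  have shift: "s k m * w = \<omega> ^ k *\<^sub>C s k (Suc m)" for k m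
  proof -
    have "\<omega> ^ k * cnj \<omega> ^ (k * Suc m) = cnj \<omega> ^ (k * m)"
      by (simp add: power_add pw mult.assoc[symmetric])
    then show ?thesis
      by (simp add: s_def mult_scaleC_left scaleC_scaleC power_commutes del: mult_Suc_right)
  qed
  have per: "s k N = s k 0" for k
    using N \<omega> by (simp add: s_def mult.commute[of k N] power_mult)
  have "(\<Sum>m<N. s k (Suc m)) = (\<Sum>m<N. s k m)" for k
    using sum.lessThan_Suc_shift[of "s k" N] sum.lessThan_Suc[of "s k" N] per[of k] by simp
  then have aw: "a k * w = \<omega> ^ k *\<^sub>C a k" for k
    by (simp add: a_def mult_scaleC_left sum_distrib_right shift scaleC_scaleC mult.commute
        flip: cvec.scale_sum_right)
  have awm: "a k * w ^ m = \<omega> ^ (k * m) *\<^sub>C a k" for k m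
  proof (induction m)
    case (Suc m)
    have "a k * w ^ Suc m = a k * w ^ m * w" by (simp add: power_commutes mult.assoc)
    also have "\<dots> = \<omega> ^ (k * Suc m) *\<^sub>C a k"
      by (simp add: Suc mult_scaleC_left aw scaleC_scaleC power_add mult.commute)
    finally show ?case .
  qed (simp add: scaleC_one)
  have idem: "a k * a k = a k" for k
  proof -
    have "a k * s k m = a k" for m
      by (simp add: s_def mult_scaleC_right awm scaleC_scaleC scaleC_one pw)
    then have "a k * (\<Sum>m<N. s k m) = of_nat N *\<^sub>C a k"
      by (simp add: sum_distrib_left cvec.sum_constant_scale del: sum_constant)
    then show ?thesis
      using N by (subst (2) a_def) (simp add: mult_scaleC_right scaleC_scaleC scaleC_one)
  qed
  have unit: "(\<Sum>k<N. a k) = 1"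
  proof -
    have geo: "(\<Sum>k<N. cnj \<omega> ^ (k * m)) = (if m = 0 then of_nat N else 0)" if "m < N" for m
    proof (cases "m = 0")
      case False
      have "cis (2 * pi * real m / real N) \<noteq> cis (2 * pi * real 0 / real N)"
        using inj_onD[OF bij_betw_imp_inj_on[OF bij_betw_roots_unity[OF N(1)]], of m 0] that False N
        by auto
      moreover have "\<omega> ^ m = cis (2 * pi * real m / real N)"
        by (simp add: \<omega>_def DeMoivre mult_ac)
      ultimately have "\<omega> ^ m \<noteq> 1" by simp
      then have z: "cnj \<omega> ^ m \<noteq> 1" by (metis complex_cnj_one complex_cnj_power complex_cnj_cnj)
      have "(cnj \<omega> ^ m) ^ N = 1" by (metis \<omega>(3) mult.commute power_mult power_one)
      then have "(\<Sum>k<N. (cnj \<omega> ^ m) ^ k) = 0"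
        using geometric_sum[OF z, of N] by simp
      moreover have "cnj \<omega> ^ (k * m) = (cnj \<omega> ^ m) ^ k" for k
        by (simp add: mult.commute flip: power_mult)
      ultimately show ?thesis using False by simp
    qed simp
    have "(\<Sum>k<N. a k) = (1 / of_nat N) *\<^sub>C (\<Sum>m<N. (\<Sum>k<N. cnj \<omega> ^ (k * m)) *\<^sub>C w ^ m)"
      unfolding a_def s_def cvec.scale_sum_right[symmetric] cvec.scale_sum_left
      by (rule arg_cong[where f = "scaleC _"], rule sum.swap)
    also have "(\<Sum>m<N. (\<Sum>k<N. cnj \<omega> ^ (k * m)) *\<^sub>C w ^ m) =
        (\<Sum>m<N. if m = 0 then of_nat N *\<^sub>C 1 else 0)"
      by (intro sum.cong) (auto simp: geo)
    also have "(1 / of_nat N) *\<^sub>C \<dots> = 1" using N by (simp add: scaleC_scaleC scaleC_one)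
    finally show ?thesis .
  qed
  have fw: "f (w ^ m) = (\<Sum>k<N. \<omega> ^ (k * m) * f (a k))" for m
  proof -
    have "f (w ^ m) = f ((\<Sum>k<N. a k) * w ^ m)" by (simp add: unit)
    then show ?thesis
      by (simp add: sum_distrib_right awm clinearD(5)[OF f(1)] clinear_functional_scale[OF f(1)])
  qed
  have "\<omega> ^ (k * (N - 1)) = cnj \<omega> ^ k" for k
  proof -
    have "k * (N - 1) + k = N * k" using N by (cases N) auto
    then have "\<omega> ^ (k * (N - 1)) * \<omega> ^ k = 1"
      using \<omega>(2) by (metis power_add power_mult power_one)
    then show ?thesis using pw by (metis mult.assoc mult.commute mult.left_neutral)
  qed
  moreover have "cnj (f (a k)) = f (a k)" for k
    using f(2)[OF idem] Reals_cnj_iff by blast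
  ultimately show ?thesis
    using fw[of "N - 1"] fw[of 1] by simp
qed

context semisimple_fin_dim_algebra
begin

text \<open>
  If \<open>q A q\<close> is one-dimensional, then \<open>A q A\<close> is a matrix block, isomorphic as a bimodule to
  \<open>A q \<otimes> q A\<close>, and both factors afford the same character.
\<close>

lemma trace_two_sided_block:
  assumes q: "q * q = q" "q \<noteq> 0" and c: "clinear c" "\<And>x. q * x * q = c x *\<^sub>C (q :: 'a)"
    and e: "e * e = e" "\<And>h. e * h = h * e" "e * q = q"
    and eq: "e = (\<Sum>i\<in>I. x i * q * y i)"
  shows "trace (\<lambda>h. a * h * b * e) = trace (\<lambda>h. a * h * q) * trace (\<lambda>h. b * h * q)"
proof -
  have cq: "c (s * q * t) = c s * c t" and cq': "c (s * q) = c s" for s t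
  proof -
    have "c (s * q * t) *\<^sub>C q = (q * s * q) * (q * t * q)"
      by (simp add: c(2)[symmetric] mult.assoc q) (simp add: q flip: mult.assoc)
    then show "c (s * q * t) = c s * c t"
      using q(2) by (simp add: c(2) mult_scaleC_left mult_scaleC_right q scaleC_scaleC)
    have "c (s * q) *\<^sub>C q = q * s * q" by (simp add: c(2)[symmetric] mult.assoc q)
    then show "c (s * q) = c s" using q(2) by (simp add: c(2))
  qed
  have lin: "clinear (\<lambda>h. c (s * h * t))" for s t
    using c(1) by (simp add: clinear_iff distrib_left distrib_right mult_scaleC_left mult_scaleC_right)
  have f: "trace (\<lambda>h. a * h * q) = (\<Sum>i\<in>I. c (y i * a * x i))" for a
  proof -
    have "a * h * q = (\<Sum>i\<in>I. c (y i * h) *\<^sub>C (a * x i * q))" for h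
    proof -
      have "a * h * q = a * (e * h * q)"
        by (metis e(2,3) mult.assoc)
      also have "\<dots> = (\<Sum>i\<in>I. a * x i * (q * (y i * h) * q))"
        by (simp add: eq sum_distrib_left sum_distrib_right mult.assoc)
      finally show ?thesis by (simp only: c(2) mult_scaleC_right)
    qed
    then have "(\<lambda>h. a * h * q) = (\<lambda>h. \<Sum>i\<in>I. c (y i * h) *\<^sub>C (a * x i * q))" by (rule ext)
    then have "trace (\<lambda>h. a * h * q) = (\<Sum>i\<in>I. trace (\<lambda>h. c (y i * h) *\<^sub>C (a * x i * q)))"
      by (simp only: trace_sum)
    moreover have "clinear (\<lambda>h. c (y i * h))" for i
      using lin[of "y i" 1] by simp
    moreover have "c (y i * (a * x i * q)) = c (y i * a * x i)" for i
      using cq'[of "y i * a * x i"] by (simp add: mult.assoc)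
    ultimately show ?thesis by (simp add: trace_rank_one)
  qed
  have "a * h * b * e = (\<Sum>i\<in>I. \<Sum>j\<in>I. c (y i * h * x j) *\<^sub>C (a * x i * q * y j * b))" for h
  proof -
    have "a * h * b * e = a * (e * h * e) * b"
      by (metis e(1,2) mult.assoc)
    also have "\<dots> = a * (\<Sum>i\<in>I. \<Sum>j\<in>I. (x i * q * y i) * h * (x j * q * y j)) * b"
      by (simp only: eq sum_distrib_left sum_distrib_right) (rule sum.swap)
    also have "\<dots> = (\<Sum>i\<in>I. \<Sum>j\<in>I. a * x i * (q * (y i * h * x j) * q) * y j * b)"
      by (simp add: sum_distrib_left sum_distrib_right mult.assoc)
    finally show ?thesis by (simp only: c(2) mult_scaleC_right mult_scaleC_left)
  qed
  then have "(\<lambda>h. a * h * b * e) =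
      (\<lambda>h. \<Sum>i\<in>I. \<Sum>j\<in>I. c (y i * h * x j) *\<^sub>C (a * x i * q * y j * b))" by (rule ext)
  then have "trace (\<lambda>h. a * h * b * e) =
      (\<Sum>i\<in>I. \<Sum>j\<in>I. trace (\<lambda>h. c (y i * h * x j) *\<^sub>C (a * x i * q * y j * b)))"
    by (simp only: trace_sum)
  also have "\<dots> = (\<Sum>i\<in>I. \<Sum>j\<in>I. c (y i * a * x i) * c (y j * b * x j))"
  proof (intro sum.cong refl)
    fix i j
    have "trace (\<lambda>h. c (y i * h * x j) *\<^sub>C (a * x i * q * y j * b)) =
        c ((y i * a * x i) * q * (y j * b * x j))"
      by (subst trace_rank_one[OF lin]) (simp add: mult.assoc)
    then show "trace (\<lambda>h. c (y i * h * x j) *\<^sub>C (a * x i * q * y j * b)) =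
        c (y i * a * x i) * c (y j * b * x j)" by (simp only: cq)
  qed
  finally show ?thesis by (simp add: f sum_product)
qed

text \<open>
  On a single matrix block the trace of conjugation by \<open>u\<close> is \<open>f u * f u'\<close>, where \<open>f\<close> is the character of
  the simple module. After rescaling, \<open>u\<close> has finite order on the block and the two factors are
  complex conjugates.
\<close>

lemma trace_conjugation_block_nonneg:
  assumes q: "q * q = q" "q \<noteq> 0" "\<And>x. \<exists>c. q * x * q = c *\<^sub>C (q :: 'a)"
    and e: "e * e = e" "\<And>h. e * h = h * e" "e * q = q"
      "e \<in> cvec.span {x * q * y | x y. True}"
    and u: "u * u' = 1" "u' * u = 1" "N > 0" "\<And>z. u ^ N * z = z * u ^ N"
  shows "\<exists>r\<ge>0. trace (\<lambda>h. u * h * u' * e) = complex_of_real r"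
proof -
  obtain c where c: "\<And>x. q * x * q = c x *\<^sub>C q" using q(3) by metis
  have "c (x + y) *\<^sub>C q = (c x + c y) *\<^sub>C q" "c (k *\<^sub>C x) *\<^sub>C q = (k * c x) *\<^sub>C q" for k x y
    by (simp_all add: c[symmetric] scaleC_add_left distrib_left distrib_right mult_scaleC_left
        mult_scaleC_right flip: scaleC_scaleC)
  then have "clinear c"
    using q(2) by (simp add: clinear_iff scaleC_complex_def)
  obtain A r where A: "finite A" "A \<subseteq> {x * q * y | x y. True}" "e = (\<Sum>a\<in>A. r a *\<^sub>C a)"
    using e(4) by (auto simp: cvec.span_explicit)
  then obtain X Y where XY: "\<And>a. a \<in> A \<Longrightarrow> a = X a * q * Y a" by (simp add: subset_iff) metis
  have e_sum: "e = (\<Sum>a\<in>A. (r a *\<^sub>C X a) * q * Y a)"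
    unfolding A(3) by (intro sum.cong refl) (metis XY mult_scaleC_left)
  define f where "f a = trace (\<lambda>h. a * h * q)" for a
  have f_lin: "clinear f"
    by (simp add: clinear_iff f_def distrib_right mult_scaleC_left trace_add trace_scale scaleC_complex_def)
  have f_real: "f a \<in> \<real>" if "a * a = a" for a
  proof -
    have "f a = of_nat (cvec.dim (range (\<lambda>h. a * h * q)))"
      unfolding f_def
      by (rule trace_idempotent) (auto intro!: clinear_intros simp: mult.assoc q(1) simp:
          mult.assoc[symmetric, of a a] that)
    then show ?thesis by simp
  qed
  have fe: "f (a * e) = f a" for a
    unfolding f_def by (metis e(2,3) mult.assoc)
  \<comment> \<open>The central element \<open>u ^ N\<close> acts on the block by a scalar; rescale \<open>u\<close> to make it \<open>1\<close>.\<close>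
  define c0 where "c0 = c (u ^ N)"
  have uNq: "u ^ N * q = c0 *\<^sub>C q"
    using u(4)[of q] q(1) c[of "u ^ N"] by (metis c0_def mult.assoc)
  have "u' ^ N * u ^ N = 1"
    using u(1,2) by (metis left_right_inverse_power)
  then have "c0 \<noteq> 0" using uNq q(2) by (metis cvec.scale_zero_left mult.assoc mult.left_neutral mult_zero_right)
  define \<rho> where "\<rho> = rcis (root N (cmod c0)) (Arg c0 / N)"
  have "\<rho> ^ N = c0"
    using u(3) by (simp add: \<rho>_def DeMoivre2 rcis_cmod_Arg)
  with \<open>c0 \<noteq> 0\<close> u(3) have "\<rho> \<noteq> 0" by (auto simp: power_0_left)
  define v where "v = (1 / \<rho>) *\<^sub>C u"
  have v_pow: "v ^ m = (1 / \<rho>) ^ m *\<^sub>C u ^ m" for m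
    by (induction m) (simp_all add: v_def scaleC_one mult_scaleC_left mult_scaleC_right scaleC_scaleC)
  have vNe: "v ^ N * e = e"
  proof -
    have "v ^ N * (x * q * y) = x * q * y" for x y
    proof -
      have "v ^ N * (x * q * y) = x * (v ^ N * q) * y"
        unfolding mult.assoc[symmetric]
          by (simp only: v_pow mult_scaleC_left mult_scaleC_right u(4))
      also have "v ^ N * q = q"
        using \<open>\<rho> ^ N = c0\<close> \<open>c0 \<noteq> 0\<close>
        by (simp add: v_pow mult_scaleC_left uNq scaleC_scaleC scaleC_one power_one_over)
      finally show ?thesis .
    qed
    then show ?thesis by (subst (1 2) e_sum) (simp add: sum_distrib_left)
  qed
  define w where "w = v * e + (1 - e)"
  have w_pow: "w ^ m = v ^ m * e + (1 - e)" for m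
  proof (induction m)
    case (Suc m)
    have "e * (1 - e) = 0" by (simp add: right_diff_distrib e(1))
    moreover have "(1 - e) * (1 - e) = 1 - e" by (simp add: algebra_simps e(1))
    moreover have "(v * e) * (v ^ m * e) = v ^ Suc m * e"
      by (metis (no_types) e(1,2) mult.assoc power_Suc)
    moreover have "(1 - e) * (v ^ m * e) = 0"
      by (metis (no_types) cancel_comm_monoid_add_class.diff_cancel e(1,2) left_diff_distrib mult.assoc mult_1)
    ultimately show ?case
      unfolding power_Suc Suc unfolding w_def by (simp add: distrib_left distrib_right mult.assoc)
  qed simp
  have fw: "f (w ^ m) = f (v ^ m)" for m
  proof -
    have "f (1 - e) = f ((1 - e) * e)" by (rule fe[symmetric])
    also have "\<dots> = 0" by (simp add: left_diff_distrib e(1) clinearD[OF f_lin])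
    finally show ?thesis by (simp add: w_pow clinearD[OF f_lin] fe)
  qed
  have "w ^ N = 1" by (simp add: w_pow vNe)
  with u(3) have "f (w ^ (N - 1)) = cnj (f w)"
    using functional_power_conjugate[OF f_lin f_real] by blast
  then have conj: "f (v ^ (N - 1)) = cnj (f v)" using fw fw[of 1] by simp
  have "v ^ (N - 1) * e = \<rho> *\<^sub>C u' * e"
  proof -
    have "(\<rho> *\<^sub>C u') * v = 1"
      using \<open>\<rho> \<noteq> 0\<close> u by (simp add: v_def mult_scaleC_left mult_scaleC_right scaleC_scaleC scaleC_one)
    then have "v ^ (N - 1) * e = (\<rho> *\<^sub>C u') * (v * v ^ (N - 1)) * e"
      by (simp flip: mult.assoc)
    also have "v * v ^ (N - 1) = v ^ N" using u(3) by (cases N) auto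
    finally show ?thesis using vNe by (simp add: mult.assoc)
  qed
  then have "f (v ^ (N - 1)) = \<rho> * f u'"
    by (metis clinear_functional_scale f_lin fe mult_scaleC_left)
  moreover have "f u = \<rho> * f v"
    using \<open>\<rho> \<noteq> 0\<close> by (simp add: v_def clinear_functional_scale[OF f_lin])
  ultimately have "f u * f u' = f v * cnj (f v)" using conj by simp
  then have "f u * f u' = complex_of_real ((cmod (f v))\<^sup>2)" by (simp only: complex_norm_square)
  moreover have "trace (\<lambda>h. u * h * u' * e) = f u * f u'"
    unfolding f_def
    by (rule trace_two_sided_block[OF q(1,2) \<open>clinear c\<close> c e(1-3) e_sum])
  ultimately show ?thesis by (intro exI[of _ "(cmod (f v))\<^sup>2"]) simp
qed

text \<open>
  Split off one matrix block after the other; \<open>e\<close> is the unit of the blocks that remain.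
\<close>

lemma trace_conjugation_nonneg:
  assumes e: "e * e = e" "\<And>h. e * h = h * (e :: 'a)"
    and u: "u * u' = 1" "u' * u = 1" "N > 0" "\<And>z. u ^ N * z = z * u ^ N"
  shows "\<exists>r\<ge>0. trace (\<lambda>h. u * h * u' * e) = complex_of_real r"
  using e
proof (induction "cvec.dim (range (\<lambda>h. h * e))" arbitrary: e rule: less_induct)
  case (less e)
  show ?case
  proof (cases "e = 0")
    case True
    then show ?thesis by (intro exI[of _ 0]) (simp add: trace_zero)
  next
    case False
    have "1 * e \<in> range (\<lambda>h. h * e)" by blast
    with False have "range (\<lambda>h. h * e) \<noteq> {0}" by auto
    from exists_primitive_idempotent[OF left_ideal_principal this]
    obtain q where q: "q \<in> range (\<lambda>h. h * e)" "q \<noteq> 0" "q * q = q" "\<And>x. \<exists>c. q * x * q = c *\<^sub>C q"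
      by metis
    define P where "P = {x * q * y | x y. True}"
    have "two_sided_ideal (cvec.span P)"
      unfolding two_sided_ideal_def
    proof (intro conjI allI ballI)
      fix a z assume z: "z \<in> cvec.span P"
      have "(\<lambda>h. a * h) ` P \<subseteq> P" "(\<lambda>h. h * a) ` P \<subseteq> P"
        unfolding P_def by (auto, (metis mult.assoc)+)
      then have "(\<lambda>h. a * h) ` cvec.span P \<subseteq> cvec.span P"
        "(\<lambda>h. h * a) ` cvec.span P \<subseteq> cvec.span P"
        by (simp_all only: span_image_clinear[symmetric] clinear_intros cvec.span_mono)
      with z show "a * z \<in> cvec.span P" "z * a \<in> cvec.span P" by auto
    qed (rule cvec.subspace_span)
    then obtain d where d: "d \<in> cvec.span P" "\<And>x. x \<in> cvec.span P \<Longrightarrow> x * d = x" "\<And>h. d * h = h * d"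
      using two_sided_ideal_central_idempotent by blast
    have "q = 1 * q * 1" by simp
    then have "q \<in> P" unfolding P_def by blast
    then have dq: "d * q = q" using d(2)[of q] d(3)[of q] by (simp add: cvec.span_base)
    have dd: "d * d = d" using d by blast
    have "e * q = q" using q(1) less.prems(1) less.prems(2)[of q] by (auto simp: mult.assoc)
    then have "P \<subseteq> {z. e * z = z}"
      unfolding P_def by (auto, metis less.prems(2) mult.assoc)
    moreover have "cvec.subspace {z. e * z = z}"
      by (auto simp: cvec.subspace_def distrib_left mult_scaleC_right)
    ultimately have "cvec.span P \<subseteq> {z. e * z = z}" by (rule cvec.span_minimal)
    then have ed: "e * d = d" "d * e = d" using d by auto
    define e' where "e' = e - d"
    have e': "e' * e' = e'"
      by (simp add: e'_def right_diff_distrib left_diff_distrib less.prems(1) ed dd)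
    have e'_central: "e' * h = h * e'" for h
      using less.prems(2)[of h] d(3)[of h] by (simp add: e'_def right_diff_distrib left_diff_distrib)
    have "range (\<lambda>h. h * e') \<subset> range (\<lambda>h. h * e)"
    proof (rule psubsetI)
      show "range (\<lambda>h. h * e') \<subseteq> range (\<lambda>h. h * e)"
      proof clarify
        fix h
        have "h * e' = (h * e') * e" by (simp add: e'_def right_diff_distrib left_diff_distrib less.prems(1) ed mult.assoc)
        then show "h * e' \<in> range (\<lambda>h. h * e)" by blast
      qed
      have "d = d * e" using ed by simp
      moreover have "d \<noteq> h * e'" for h
      proof
        assume "d = h * e'"
        then have "d * d = h * (e' * d)" by (simp add: mult.assoc)
        also have "e' * d = 0" by (simp add: e'_def left_diff_distrib ed dd)
        finally show False using dd dq q(2) by simp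
      qed
      ultimately show "range (\<lambda>h. h * e') \<noteq> range (\<lambda>h. h * e)" by blast
    qed
    then have "cvec.dim (range (\<lambda>h. h * e')) < cvec.dim (range (\<lambda>h. h * e))"
      using left_ideal_principal[of e] left_ideal_principal[of e']
      by (intro fd.dim_psubset) (simp add: left_ideal_def cvec.span_eq_iff[THEN iffD2])
    from less.hyps[OF this e' e'_central] obtain r where r: "r \<ge> 0" "trace (\<lambda>h. u * h * u' * e') = complex_of_real r"
      by blast
    obtain s where s: "s \<ge> 0" "trace (\<lambda>h. u * h * u' * d) = complex_of_real s"
      using trace_conjugation_block_nonneg[OF q(3,2,4) dd d(3) dq d(1)[unfolded P_def] u] by blast
    have "trace (\<lambda>h. u * h * u' * e) = trace (\<lambda>h. u * h * u' * e' + u * h * u' * d)"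
      by (simp add: e'_def right_diff_distrib)
    also have "\<dots> = complex_of_real (r + s)" by (simp add: trace_add r s)
    finally show ?thesis using r s by (intro exI[of _ "r + s"]) simp
  qed
qed

end

section \<open>Calculating in Sweedler notation\<close>

lemma clinear_tensor_lift:
  "clinear f \<Longrightarrow> f (tensor_lift B t) = tensor_lift (\<lambda>x y. f (B x y)) t"
  by (simp add: tensor_lift_def free_lift_def clinearD)

lemma tensor_lift_swap:
  "tensor_lift (\<lambda>a b. tensor_lift (F a b) s) t = tensor_lift (\<lambda>c d. tensor_lift (\<lambda>a b. F a b c d) t) s"
  unfolding tensor_lift_def free_lift_def cvec.scale_sum_right
  by (subst sum.swap) (simp only: cvec.scale_left_commute)

lemma clinear_tensor_lift_param:
  assumes "\<And>a b. clinear (F a b)"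
  shows "clinear (\<lambda>x. tensor_lift (\<lambda>a b. F a b x) t)"
  unfolding tensor_lift_def free_lift_def by (intro clinear_intros assms)

lemma cbilinearI:
  "(\<And>y. clinear (\<lambda>x. B x y)) \<Longrightarrow> (\<And>x. clinear (\<lambda>y. B x y)) \<Longrightarrow> cbilinear B"
  by (simp add: cbilinear_def)

lemma clinear_tensor_of:
  "clinear f \<Longrightarrow> clinear (\<lambda>x. f x \<otimes> z)" "clinear f \<Longrightarrow> clinear (\<lambda>x. z \<otimes> f x)"
  by (simp_all add: clinear_iff tensor_of_simps)

context hopf_algebra
begin

text \<open>
  In Sweedler notation, \<open>sw B h\<close> is \<open>B(h\<^sub>1, h\<^sub>2)\<close>; higher iterated coproducts are nested uses. Linear maps
  can be moved through \<open>sw\<close>, and two of them can be interchanged, for arbitrary \<open>B\<close>, since \<open>sw B h\<close> is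
  a finite sum over a fixed representative of \<open>\<Delta> h\<close>; the rules that come from the axioms ask for
  multilinear arguments, which the collection \<open>lin\<close> establishes.
\<close>

definition sw :: "('h \<Rightarrow> 'h \<Rightarrow> 'v::complex_vector) \<Rightarrow> 'h \<Rightarrow> 'v" where
  "sw B h = tensor_lift B (\<Delta> h)"

lemma clinear_sw: "clinear f \<Longrightarrow> f (sw B h) = sw (\<lambda>x y. f (B x y)) h"
  unfolding sw_def by (rule clinear_tensor_lift)

lemma sw_swap: "sw (\<lambda>a b. sw (F a b) h) g = sw (\<lambda>c d. sw (\<lambda>a b. F a b c d) g) h"
  unfolding sw_def by (rule tensor_lift_swap)

lemmas clinear_counit = clinear_compose[OF counit_linear]
lemmas clinear_antipode = clinear_compose[OF antipode_linear]

lemma clinear_sw_arg: "cbilinear B \<Longrightarrow> clinear g \<Longrightarrow> clinear (\<lambda>x. sw B (g x))"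
  unfolding sw_def
  by (intro clinear_compose[OF tensor_lift_linear] clinear_compose[OF comult_linear])

lemma clinear_sw_param: "(\<And>a b. clinear (F a b)) \<Longrightarrow> clinear (\<lambda>x. sw (\<lambda>a b. F a b x) h)"
  unfolding sw_def by (rule clinear_tensor_lift_param)

lemmas lin = cbilinearI clinear_intros clinear_tensor_of clinear_counit clinear_antipode
  clinear_sw_arg clinear_sw_param

lemma sw_coassoc:
  assumes T: "\<And>y z. clinear (\<lambda>x. T x y z)" "\<And>x z. clinear (\<lambda>y. T x y z)" "\<And>x y. clinear (T x y)"
  shows "sw (\<lambda>x z. sw (\<lambda>a b. T a b z) x) h = sw (\<lambda>x y. sw (T x) y) h"
proof -
  have Tx: "cbilinear (T x)" for x by (intro cbilinearI T)
  have T1: "cbilinear (\<lambda>x t. tensor_lift (T x) t)"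
    by (intro cbilinearI clinear_tensor_lift_param T tensor_lift_linear[OF Tx, THEN clinear_compose]
        clinear_intros)
  define \<phi> where "\<phi> = tensor_lift (\<lambda>x t. tensor_lift (T x) t)"
  have \<phi>: "clinear \<phi>" "\<phi> (x \<otimes> t) = tensor_lift (T x) t" for x t
    unfolding \<phi>_def using T1 by (simp_all add: tensor_lift_linear tensor_lift_tensor_of)
  have b: "cbilinear (\<lambda>x y. x \<otimes> (y \<otimes> z))" for z :: 'h
    by (intro cbilinearI clinear_tensor_of clinear_intros)
  have "cbilinear (\<lambda>t z. tensor_lift (\<lambda>x y. x \<otimes> (y \<otimes> z)) t :: 'h \<otimes> 'h \<otimes> 'h)"
    by (rule cbilinear_lift[OF b]) (intro clinear_tensor_of clinear_intros)
  then have assoc: "clinear (tensor_assoc :: ('h \<otimes> 'h) \<otimes> 'h \<Rightarrow> _)"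
      "tensor_assoc (t \<otimes> z) = tensor_lift (\<lambda>x y. x \<otimes> (y \<otimes> z)) t" for t :: "'h \<otimes> 'h" and z :: 'h
    unfolding tensor_assoc_def by (simp_all add: tensor_lift_linear tensor_lift_tensor_of)
  have "\<phi> (tensor_assoc (tensor_map \<Delta> id (\<Delta> h))) = \<phi> (tensor_map id \<Delta> (\<Delta> h))"
    by (simp add: coassoc)
  also have "\<phi> (tensor_map id \<Delta> (\<Delta> h)) = sw (\<lambda>x y. sw (T x) y) h"
    by (simp add: tensor_map_def clinear_tensor_lift[OF \<phi>(1)] \<phi>(2) sw_def)
  also have "\<phi> (tensor_assoc (tensor_map \<Delta> id (\<Delta> h))) = sw (\<lambda>x z. sw (\<lambda>a b. T a b z) x) h"
    by (simp add: tensor_map_def clinear_tensor_lift[OF assoc(1)] clinear_tensor_lift[OF \<phi>(1)]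
        assoc(2) \<phi>(2) tensor_lift_tensor_of[OF Tx] sw_def)
  finally show ?thesis .
qed

lemma sw_counit_left:
  assumes "clinear f"
  shows "sw (\<lambda>x y. \<epsilon> x *\<^sub>C f y) h = f h"
  using clinear_sw[OF assms, of "\<lambda>x y. \<epsilon> x *\<^sub>C y" h]
  by (simp add: clinearD[OF assms] sw_def counit_left)

lemma sw_counit_right:
  assumes "clinear f"
  shows "sw (\<lambda>x y. \<epsilon> y *\<^sub>C f x) h = f h"
  using clinear_sw[OF assms, of "\<lambda>x y. \<epsilon> y *\<^sub>C x" h]
  by (simp add: clinearD[OF assms] sw_def counit_right)

lemma sw_mult: 
  assumes "cbilinear B"
  shows "sw B (g * h) = sw (\<lambda>a b. sw (\<lambda>c d. B (a * c) (b * d)) h) g"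
  unfolding sw_def comult_mult tensor_mult_def
  by (simp add: clinear_tensor_lift[OF tensor_lift_linear[OF assms]] tensor_lift_tensor_of[OF assms])

lemma sw_one: "cbilinear B \<Longrightarrow> sw B 1 = B 1 1"
  by (simp add: sw_def comult_one tensor_lift_tensor_of)

lemma sw_antipode_left: "clinear f \<Longrightarrow> sw (\<lambda>x y. f (S x * y)) h = \<epsilon> h *\<^sub>C f 1"
  using clinear_sw[of f "\<lambda>x y. S x * y" h] by (simp add: sw_def antipode_left clinearD)

lemma sw_antipode_right: "clinear f \<Longrightarrow> sw (\<lambda>x y. f (x * S y)) h = \<epsilon> h *\<^sub>C f 1"
  using clinear_sw[of f "\<lambda>x y. x * S y" h] by (simp add: sw_def antipode_right clinearD)

lemma sw_diff: "sw (\<lambda>a b. B a b - C a b) h = sw B h - sw C h"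
  by (simp add: sw_def tensor_lift_def free_lift_def cvec.scale_right_diff_distrib sum_subtractf)

lemma sw_eq_0: "(\<And>a b. B a b = 0) \<Longrightarrow> sw B h = 0"
  by (simp add: sw_def tensor_lift_def free_lift_def)

lemma counit_scale: "\<epsilon> (c *\<^sub>C x) = c * \<epsilon> x"
  by (simp add: clinear_functional_scale counit_linear)

lemma sw_scale: "sw (\<lambda>a b. c *\<^sub>C B a b) h = c *\<^sub>C sw B h"
  by (rule clinear_sw[symmetric]) (intro clinear_intros)

text \<open>
  \<open>h\<^sub>1 l(k h\<^sub>2) = S(k\<^sub>1) k\<^sub>2 h\<^sub>1 l(k\<^sub>3 h\<^sub>2) = S(k\<^sub>1) l(k\<^sub>2 h)\<close>, where the integral property is applied to the
  product \<open>k\<^sub>2 h\<close>.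
\<close>

lemma left_integral_shift:
  assumes "left_integral l"
  shows "sw (\<lambda>a b. l (k * b) *\<^sub>C a) h = sw (\<lambda>c d. l (d * h) *\<^sub>C S c) k"
proof -
  have l: "clinear l" "\<And>h. sw (\<lambda>x y. l y *\<^sub>C x) h = l h *\<^sub>C 1"
    using assms by (auto simp: left_integral_def sw_def)
  note lin = lin clinear_compose[OF l(1)]
  define G where "G c p q = sw (\<lambda>a b. l (q * b) *\<^sub>C (c * p * a)) h" for c p q
  have "l (d * h) *\<^sub>C S c = sw (\<lambda>p q. G (S c) p q) d" for c d
  proof -
    have "l (d * h) *\<^sub>C S c = S c * sw (\<lambda>x y. l y *\<^sub>C x) (d * h)"
      by (simp add: l mult_scaleC_right)
    also have "\<dots> = S c * sw (\<lambda>p q. sw (\<lambda>a b. l (q * b) *\<^sub>C (p * a)) h) d"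
      by (subst sw_mult) (intro lin | simp)+
    also have "\<dots> = sw (\<lambda>p q. G (S c) p q) d"
      by (simp add: clinear_sw[where f = "\<lambda>x. S c * x"] clinear_intros G_def mult_scaleC_right mult.assoc)
    finally show ?thesis .
  qed
  then have "sw (\<lambda>c d. l (d * h) *\<^sub>C S c) k = sw (\<lambda>c d. sw (\<lambda>p q. G (S c) p q) d) k"
    by simp
  also have "\<dots> = sw (\<lambda>x q. sw (\<lambda>c p. G (S c) p q) x) k"
    unfolding G_def by (rule sw_coassoc[symmetric]) (intro lin)+
  also have "\<dots> = sw (\<lambda>x q. \<epsilon> x *\<^sub>C G 1 1 q) k"
  proof -
    have "sw (\<lambda>c p. G (S c) p q) x = \<epsilon> x *\<^sub>C G 1 1 q" for x q
    proof -
      have "clinear (\<lambda>z. sw (\<lambda>a b. l (q * b) *\<^sub>C (z * a)) h)" by (intro lin)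
      from sw_antipode_left[OF this, of x] show ?thesis by (simp add: G_def)
    qed
    then show ?thesis by simp
  qed
  also have "\<dots> = G 1 1 k"
    unfolding G_def by (rule sw_counit_left) (intro lin)
  finally show ?thesis by (simp add: G_def)
qed

end

section \<open>Integrals as Frobenius forms\<close>

lemma (in fin_dim_space) trace_tensor_lift:
  assumes "\<And>b. clinear (\<phi> b)"
  shows "trace (\<lambda>h. tensor_lift (\<lambda>a b. \<phi> b h *\<^sub>C v a) t) = tensor_lift (\<lambda>a b. \<phi> b (v a)) t"
  by (simp only: tensor_lift_def free_lift_def trace_sum trace_scale trace_rank_one[OF assms]
      scaleC_complex_def)

locale hopf_algebra_with_integral = hopf_algebra \<Delta> \<epsilon> S + fin_dim_algebra Bas
  for \<Delta> :: "'h::complex_algebra_1 \<Rightarrow> 'h \<otimes> 'h" and \<epsilon> S and Bas :: "'h set" +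
  fixes l :: "'h \<Rightarrow> complex"
  assumes integral: "left_integral l"
    and integral_nonzero: "l \<noteq> (\<lambda>h. 0)"
begin

lemma clinear_l: "clinear l"
  using integral by (simp add: left_integral_def)

lemma sw_integral: "sw (\<lambda>x y. l y *\<^sub>C x) h = l h *\<^sub>C 1"
  using integral by (simp add: left_integral_def sw_def)

lemmas lin = lin clinear_compose[OF clinear_l] clinear_compose[OF clinear_regular_character]

lemmas l_shift = left_integral_shift[OF integral]

text \<open>
  The right radical of the form \<open>(k, x) \<mapsto> l(k x)\<close> is a left ideal and a left coideal, so it contains
  \<open>S(x\<^sub>1) x\<^sub>2 = \<epsilon>(x) 1\<close> with \<open>x\<close>. As \<open>l\<close> is not zero, the counit vanishes on the radical, and a left coideal in
  the kernel of the counit is zero.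
\<close>

lemma integral_nondegenerate:
  assumes x: "\<And>k. l (k * x) = 0"
  shows "x = 0"
proof -
  have counit0: "\<epsilon> y = 0" if y: "\<And>k. l (k * y) = 0" for y
  proof -
    have slice: "sw (\<lambda>a b. l (m * b) *\<^sub>C a) y = 0" for m
      using y by (simp add: l_shift sw_eq_0)
    have "\<epsilon> y * l k = 0" for k
    proof -
      have "\<epsilon> y * l k = sw (\<lambda>a b. l (k * (S a * b))) y"
        using sw_antipode_left[of "\<lambda>z. l (k * z)" y] by (simp add: scaleC_complex_def lin)
      also have "(\<lambda>a b. l (k * (S a * b))) =
          (\<lambda>a b. \<Sum>\<beta>\<in>Bas. coord \<beta> (k * S a) * l (\<beta> * b))"
      proof (intro ext)
        fix a b
        have "l (k * (S a * b)) = l ((\<Sum>\<beta>\<in>Bas. coord \<beta> (k * S a) *\<^sub>C \<beta>) * b)"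
          by (simp add: sum_coord mult.assoc)
        then show "l (k * (S a * b)) = (\<Sum>\<beta>\<in>Bas. coord \<beta> (k * S a) * l (\<beta> * b))"
          by (simp add: sum_distrib_right mult_scaleC_left clinearD(5)[OF clinear_l]
              clinear_functional_scale[OF clinear_l])
      qed
      also have "sw \<dots> y = (\<Sum>\<beta>\<in>Bas. sw (\<lambda>a b. coord \<beta> (k * S a) * l (\<beta> * b)) y)"
        by (simp add: sw_def tensor_lift_def free_lift_def cvec.scale_sum_right) (rule sum.swap)
      also have "\<dots> = 0"
      proof (intro sum.neutral ballI)
        fix \<beta>
        have f: "clinear (\<lambda>a. coord \<beta> (k * S a))"
          by (intro clinear_compose[OF clinear_coord] lin)
        show "sw (\<lambda>a b. coord \<beta> (k * S a) * l (\<beta> * b)) y = 0"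
          using clinear_sw[OF f, of "\<lambda>a b. l (\<beta> * b) *\<^sub>C a" y]
          by (simp add: slice clinearD[OF f] clinear_functional_scale[OF f] scaleC_complex_def mult.commute)
      qed
      finally show ?thesis .
    qed
    moreover obtain k where "l k \<noteq> 0" using integral_nonzero by auto
    ultimately show ?thesis using mult_eq_0_iff by blast
  qed
  obtain k where k: "\<And>y. \<epsilon> y = l (k * y)"
    by (rule functional_representation[of l UNIV UNIV \<epsilon>])
      (auto intro: clinear_l counit_linear counit0)
  have "x = sw (\<lambda>a b. \<epsilon> b *\<^sub>C a) x" by (simp add: sw_def counit_right)
  also have "\<dots> = sw (\<lambda>c d. l (d * x) *\<^sub>C S c) k" by (simp add: k l_shift)
  also have "\<dots> = 0" using x by (simp add: sw_eq_0)
  finally show ?thesis .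
qed

lemma integral_nonzero_on_integral:
  assumes "\<And>h. h * \<Lambda> = \<epsilon> h *\<^sub>C \<Lambda>" "\<Lambda> \<noteq> 0"
  shows "l \<Lambda> \<noteq> 0"
  using integral_nondegenerate[of \<Lambda>] assms
  by (auto simp: clinear_functional_scale[OF clinear_l])

end

locale hopf_algebra_integral_pair = hopf_algebra_with_integral \<Delta> \<epsilon> S Bas l
  for \<Delta> :: "'h::complex_algebra_1 \<Rightarrow> 'h \<otimes> 'h" and \<epsilon> S Bas l +
  fixes \<Lambda> :: 'h
  assumes Lam_left: "h * \<Lambda> = \<epsilon> h *\<^sub>C \<Lambda>"
    and counit_Lam: "\<epsilon> \<Lambda> = 1"
    and l_Lam: "l \<Lambda> = 1"
begin

text \<open>
  \<open>\<Lambda> h\<close> is again a left integral in \<open>H\<close>, hence a multiple of \<open>\<Lambda>\<close>; the counit, which does not vanish at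
  \<open>\<Lambda>\<close>, identifies the factor.
\<close>

lemma Lam_right: "\<Lambda> * h = \<epsilon> h *\<^sub>C \<Lambda>"
proof -
  have eq: "\<Lambda> * h = l (\<Lambda> * h) *\<^sub>C \<Lambda>"
  proof -
    have "l (k * (\<Lambda> * h - l (\<Lambda> * h) *\<^sub>C \<Lambda>)) = 0" for k
      by (simp add: right_diff_distrib mult_scaleC_right Lam_left l_Lam mult_scaleC_left
          clinearD(4)[OF clinear_l] clinear_functional_scale[OF clinear_l] flip: mult.assoc)
    from integral_nondegenerate[OF this] show ?thesis by simp
  qed
  have "\<epsilon> (\<Lambda> * h) = l (\<Lambda> * h)" by (subst eq) (simp add: counit_scale counit_Lam)
  with eq show ?thesis by (simp add: counit_mult counit_Lam)
qed

text \<open>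
  The Casimir properties of an integral: \<open>\<Lambda>\<^sub>1 \<otimes> k \<Lambda>\<^sub>2 = S(k) \<Lambda>\<^sub>1 \<otimes> \<Lambda>\<^sub>2\<close> and
  \<open>\<Lambda>\<^sub>1 k \<otimes> \<Lambda>\<^sub>2 = \<Lambda>\<^sub>1 \<otimes> \<Lambda>\<^sub>2 S(k)\<close>. They follow by inserting \<open>S(k\<^sub>1) k\<^sub>2\<close> and \<open>k\<^sub>2 S(k\<^sub>3)\<close>.
\<close>

lemma sw_Lam_left:
  assumes "\<And>y. clinear (\<lambda>x. B x y)" "\<And>x. clinear (B x)"
  shows "sw (\<lambda>a b. B a (k * b)) \<Lambda> = sw (\<lambda>a b. B (S k * a) b) \<Lambda>"
proof -
  note lin = lin clinear_compose[OF assms(1)] clinear_compose[OF assms(2)]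
  define G where "G c p q = sw (\<lambda>a b. B (c * p * a) (q * b)) \<Lambda>" for c p q
  have "sw (\<lambda>a b. B (S k * a) b) \<Lambda> = sw (\<lambda>c d. \<epsilon> d *\<^sub>C sw (\<lambda>a b. B (S c * a) b) \<Lambda>) k"
    by (rule sw_counit_right[symmetric]) (intro lin)
  also have "\<dots> = sw (\<lambda>c d. sw (\<lambda>p q. G (S c) p q) d) k"
  proof -
    have "\<epsilon> d *\<^sub>C sw (\<lambda>a b. B (S c * a) b) \<Lambda> = sw (\<lambda>p q. G (S c) p q) d" for c d
    proof -
      have cb: "cbilinear (\<lambda>a b. B (S c * a) b)" by (intro lin)
      have "\<epsilon> d *\<^sub>C sw (\<lambda>a b. B (S c * a) b) \<Lambda> = sw (\<lambda>a b. B (S c * a) b) (d * \<Lambda>)"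
        using clinear_sw_arg[OF cb clinear_intros(1)] by (simp add: Lam_left clinearD)
      then show ?thesis by (simp add: sw_mult[OF cb] G_def mult.assoc)
    qed
    then show ?thesis by simp
  qed
  also have "\<dots> = sw (\<lambda>x q. sw (\<lambda>c p. G (S c) p q) x) k"
    unfolding G_def by (rule sw_coassoc[symmetric]) (intro lin)+
  also have "\<dots> = sw (\<lambda>x q. \<epsilon> x *\<^sub>C G 1 1 q) k"
  proof -
    have "sw (\<lambda>c p. G (S c) p q) x = \<epsilon> x *\<^sub>C G 1 1 q" for x q
    proof -
      have "clinear (\<lambda>z. sw (\<lambda>a b. B (z * a) (q * b)) \<Lambda>)" by (intro lin)
      from sw_antipode_left[OF this, of x] show ?thesis by (simp add: G_def)
    qed
    then show ?thesis by simp
  qed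
  also have "\<dots> = G 1 1 k"
    unfolding G_def by (rule sw_counit_left) (intro lin)
  finally show ?thesis by (simp add: G_def)
qed

lemma sw_Lam_right:
  assumes "\<And>y. clinear (\<lambda>x. B x y)" "\<And>x. clinear (B x)"
  shows "sw (\<lambda>a b. B (a * k) b) \<Lambda> = sw (\<lambda>a b. B a (b * S k)) \<Lambda>"
proof -
  note lin = lin clinear_compose[OF assms(1)] clinear_compose[OF assms(2)]
  define G where "G c p q = sw (\<lambda>a b. B (a * c) (b * (p * q))) \<Lambda>" for c p q
  have "sw (\<lambda>a b. B (a * k) b) \<Lambda> = sw (\<lambda>c d. \<epsilon> d *\<^sub>C G c 1 1) k"
    unfolding G_def mult_1_right by (rule sw_counit_right[symmetric]) (intro lin)
  also have "\<dots> = sw (\<lambda>c d. sw (\<lambda>p q. G c p (S q)) d) k"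
  proof -
    have "sw (\<lambda>p q. G c p (S q)) d = \<epsilon> d *\<^sub>C G c 1 1" for c d
    proof -
      have "clinear (\<lambda>z. sw (\<lambda>a b. B (a * c) (b * z)) \<Lambda>)" by (intro lin)
      from sw_antipode_right[OF this, of d] show ?thesis by (simp add: G_def)
    qed
    then show ?thesis by simp
  qed
  also have "\<dots> = sw (\<lambda>x q. sw (\<lambda>c p. G c p (S q)) x) k"
    unfolding G_def by (rule sw_coassoc[symmetric]) (intro lin)+
  also have "\<dots> = sw (\<lambda>x q. \<epsilon> x *\<^sub>C sw (\<lambda>a b. B a (b * S q)) \<Lambda>) k"
  proof -
    have "sw (\<lambda>c p. G c p (S q)) x = \<epsilon> x *\<^sub>C sw (\<lambda>a b. B a (b * S q)) \<Lambda>" for x q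
    proof -
      have cb: "cbilinear (\<lambda>a b. B a (b * S q))" by (intro lin)
      have "sw (\<lambda>c p. G c p (S q)) x = sw (\<lambda>a b. sw (\<lambda>c d. B (a * c) (b * d * S q)) x) \<Lambda>"
        unfolding G_def by (subst sw_swap) (simp add: mult.assoc)
      also have "\<dots> = sw (\<lambda>a b. B a (b * S q)) (\<Lambda> * x)"
        by (simp add: sw_mult[OF cb])
      also have "\<dots> = \<epsilon> x *\<^sub>C sw (\<lambda>a b. B a (b * S q)) \<Lambda>"
        using clinear_sw_arg[OF cb clinear_intros(1)] by (simp add: Lam_right clinearD)
      finally show ?thesis .
    qed
    then show ?thesis by simp
  qed
  also have "\<dots> = sw (\<lambda>a b. B a (b * S k)) \<Lambda>"
    by (rule sw_counit_left) (intro lin)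
  finally show ?thesis .
qed

text \<open>
  The next two formulas express the antipode and the identity as sums of rank-one operators. They
  give the injectivity of \<open>S\<close>, its compatibility with the multiplication and the comultiplication,
  and the trace formulas.
\<close>

lemma antipode_eq_sw_Lam: "S k = sw (\<lambda>a b. l (k * b) *\<^sub>C a) \<Lambda>"
proof -
  have "sw (\<lambda>a b. l (k * b) *\<^sub>C a) \<Lambda> = sw (\<lambda>c d. \<epsilon> d *\<^sub>C S c) k"
    by (simp add: l_shift Lam_left clinear_functional_scale[OF clinear_l] l_Lam)
  also have "\<dots> = S k" by (rule sw_counit_right) (rule antipode_linear)
  finally show ?thesis by simp
qed

lemma eq_sw_Lam_antipode: "k = sw (\<lambda>a b. l (b * S k) *\<^sub>C a) \<Lambda>"
proof -
  have "sw (\<lambda>a b. l (b * S k) *\<^sub>C a) \<Lambda> = sw (\<lambda>a b. l b *\<^sub>C (a * k)) \<Lambda>"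
    by (rule sw_Lam_right[symmetric]) (intro lin)+
  also have "\<dots> = sw (\<lambda>a b. l b *\<^sub>C a) \<Lambda> * k"
    by (simp add: clinear_sw[where f = "\<lambda>x. x * k"] clinear_intros mult_scaleC_left)
  finally show ?thesis by (simp add: sw_integral l_Lam scaleC_one)
qed

lemma antipode_eq_0: "S k = 0 \<Longrightarrow> k = 0"
  using eq_sw_Lam_antipode[of k]
  by (simp add: clinearD[OF clinear_l] sw_eq_0)

text \<open>
  Every functional is \<open>l(w _)\<close> for some \<open>w\<close>, and then the slice of \<open>\<Delta> \<Lambda>\<close> along it is \<open>S w\<close>.
\<close>

lemma Lam_slices_separate:
  assumes p: "clinear p" "sw (\<lambda>a b. p b *\<^sub>C a) \<Lambda> = 0"
  shows "p h = 0"
proof -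
  have "p y = 0" if "\<And>k. l (k * y) = 0" for y
    using integral_nondegenerate[OF that] clinearD(3)[OF p(1)] by simp
  then obtain w where w: "\<And>y. p y = l (w * y)"
    by (metis functional_representation[OF clinear_l cvec.subspace_UNIV cvec.subspace_UNIV p(1)] UNIV_I)
  have "S w = 0" using p(2) by (simp add: w antipode_eq_sw_Lam)
  then show ?thesis using antipode_eq_0[of w] by (simp add: w clinearD[OF clinear_l])
qed

text \<open>
  The Nakayama automorphism of \<open>l\<close> is \<open>S\<^sup>2\<close>: as functionals of \<open>h\<close> both sides have the same slice along
  \<open>\<Delta> \<Lambda>\<close>, namely \<open>S z\<close>, by the formula for the antipode at \<open>z\<close> and the formula for the identity at \<open>S z\<close>.
\<close>

lemma integral_Nakayama: "l (z * h) = l (h * S (S z))"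
proof -
  have "clinear (\<lambda>h. l (z * h) - l (h * S (S z)))" by (intro lin)
  moreover have "sw (\<lambda>a b. (l (z * b) - l (b * S (S z))) *\<^sub>C a) \<Lambda> = 0"
    by (simp add: cvec.scale_left_diff_distrib sw_diff flip: antipode_eq_sw_Lam eq_sw_Lam_antipode)
  ultimately have "l (z * h) - l (h * S (S z)) = 0" by (rule Lam_slices_separate)
  then show ?thesis by simp
qed

lemma antipode_mult: "S (h * k) = S k * S h"
proof -
  have "S (h * k) = sw (\<lambda>a b. l (h * (k * b)) *\<^sub>C a) \<Lambda>"
    by (simp add: antipode_eq_sw_Lam[of "h * k"] mult.assoc)
  also have "\<dots> = sw (\<lambda>a b. l (h * b) *\<^sub>C (S k * a)) \<Lambda>"
    by (rule sw_Lam_left) (intro lin)+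
  also have "\<dots> = S k * S h"
    by (simp add: clinear_sw[where f = "\<lambda>x. S k * x"] clinear_intros mult_scaleC_right
        antipode_eq_sw_Lam[of h])
  finally show ?thesis .
qed

lemma antipode_one: "S 1 = 1"
  using sw_antipode_left[of "\<lambda>x. x" 1] sw_one[of "\<lambda>x y. S x * y"]
  by (simp add: lin counit_one scaleC_one)

text \<open>
  The antipode reverses the coproduct: apply \<open>\<Delta>\<close> to \<open>S(h) = \<Lambda>\<^sub>1 l(h \<Lambda>\<^sub>2)\<close> and shift \<open>l\<close> across \<open>\<Lambda>\<^sub>2 \<otimes> \<Lambda>\<^sub>3\<close>.
\<close>

lemma sw_antipode:
  assumes "\<And>y. clinear (\<lambda>x. B x y)" "\<And>x. clinear (B x)"
  shows "sw B (S h) = sw (\<lambda>a b. B (S b) (S a)) h"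
proof -
  note lin = lin clinear_compose[OF assms(1)] clinear_compose[OF assms(2)]
  have "cbilinear B" by (intro lin assms)
  then have swB: "clinear (sw B)" using clinear_sw_arg[OF _ clinear_intros(1)] by blast
  have "sw B (S h) = sw (\<lambda>a b. l (h * b) *\<^sub>C sw B a) \<Lambda>"
    by (simp add: antipode_eq_sw_Lam[of h] clinear_sw[OF swB] clinearD[OF swB])
  also have "\<dots> = sw (\<lambda>a b. sw (\<lambda>p q. l (h * b) *\<^sub>C B p q) a) \<Lambda>"
    by (simp add: sw_scale)
  also have "\<dots> = sw (\<lambda>p y. sw (\<lambda>q b. l (h * b) *\<^sub>C B p q) y) \<Lambda>"
    by (rule sw_coassoc) (intro lin assms)+
  also have "\<dots> = sw (\<lambda>p y. sw (\<lambda>c d. l (d * y) *\<^sub>C B p (S c)) h) \<Lambda>"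
  proof -
    have "sw (\<lambda>q b. l (h * b) *\<^sub>C B p q) y = B p (sw (\<lambda>q b. l (h * b) *\<^sub>C q) y)" for p y
      by (simp add: clinear_sw[OF assms(2)] clinearD[OF assms(2)])
    also have "\<dots> p y = sw (\<lambda>c d. l (d * y) *\<^sub>C B p (S c)) h" for p y
      by (simp add: l_shift clinear_sw[OF assms(2)] clinearD[OF assms(2)])
    finally show ?thesis by simp
  qed
  also have "\<dots> = sw (\<lambda>c d. sw (\<lambda>p y. l (d * y) *\<^sub>C B p (S c)) \<Lambda>) h"
    by (rule sw_swap)
  also have "\<dots> = sw (\<lambda>c d. B (S d) (S c)) h"
  proof -
    have "sw (\<lambda>p y. l (d * y) *\<^sub>C B p (S c)) \<Lambda> = B (S d) (S c)" for c d
      by (simp add: antipode_eq_sw_Lam[of d] clinear_sw[OF assms(1)] clinearD[OF assms(1)])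
    then show ?thesis by simp
  qed
  finally show ?thesis .
qed

lemma sw_antipode_antipode:
  assumes "\<And>y. clinear (\<lambda>x. B x y)" "\<And>x. clinear (B x)"
  shows "sw B (S (S h)) = sw (\<lambda>a b. B (S (S a)) (S (S b))) h"
proof -
  note lin = lin clinear_compose[OF assms(1)] clinear_compose[OF assms(2)]
  have "sw B (S (S h)) = sw (\<lambda>a b. B (S b) (S a)) (S h)"
    by (rule sw_antipode) (intro assms)+
  also have "\<dots> = sw (\<lambda>a b. B (S (S a)) (S (S b))) h"
    by (rule sw_antipode) (intro lin)+
  finally show ?thesis .
qed

lemma trace_antipode:
  assumes "clinear f"
  shows "trace (\<lambda>h. f (S h)) = sw (\<lambda>a b. l (f a * b)) \<Lambda>"
proof -
  have "f (S h) = sw (\<lambda>a b. l (h * b) *\<^sub>C f a) \<Lambda>" for h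
    by (simp add: antipode_eq_sw_Lam[of h] clinear_sw[OF assms] clinearD[OF assms])
  moreover have "trace (\<lambda>h. sw (\<lambda>a b. l (h * b) *\<^sub>C f a) \<Lambda>) = sw (\<lambda>a b. l (f a * b)) \<Lambda>"
    unfolding sw_def by (rule trace_tensor_lift) (intro lin)
  ultimately show ?thesis by simp
qed

lemma trace_mult_antipode_antipode: "trace (\<lambda>h. x * S (S h)) = l x"
proof -
  have "clinear (\<lambda>h. x * S h)" by (intro lin)
  from trace_antipode[OF this] have "trace (\<lambda>h. x * S (S h)) = sw (\<lambda>a b. l (x * (S a * b))) \<Lambda>"
    by (simp add: mult.assoc)
  also have "\<dots> = \<epsilon> \<Lambda> *\<^sub>C l (x * 1)"
    by (rule sw_antipode_left) (intro lin)
  finally show ?thesis by (simp add: counit_Lam scaleC_one)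
qed

lemma left_integral_unique:
  assumes "left_integral \<mu>"
  shows "\<mu> h = \<mu> \<Lambda> * l h"
proof -
  have \<mu>: "clinear \<mu>" "sw (\<lambda>x y. \<mu> y *\<^sub>C x) \<Lambda> = \<mu> \<Lambda> *\<^sub>C 1"
    using assms by (simp_all add: left_integral_def sw_def)
  have "clinear (\<lambda>h. \<mu> h - \<mu> \<Lambda> * l h)"
    by (intro lin clinear_compose[OF \<mu>(1)])
  moreover have "sw (\<lambda>a b. (\<mu> b - \<mu> \<Lambda> * l b) *\<^sub>C a) \<Lambda> = 0"
    by (simp only: cvec.scale_left_diff_distrib sw_diff sw_scale \<mu>(2) sw_integral l_Lam
        flip: scaleC_scaleC) (simp add: scaleC_one)
  ultimately have "\<mu> h - \<mu> \<Lambda> * l h = 0" by (rule Lam_slices_separate)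
  then show ?thesis by simp
qed

end

section \<open>The fourth power of the antipode\<close>

context hopf_algebra_integral_pair
begin

text \<open>
  The distinguished grouplike element of \<open>H\<close>, which measures the failure of \<open>l\<close> to be a right
  integral.
\<close>

definition distinguished :: 'h where
  "distinguished = sw (\<lambda>a b. l a *\<^sub>C b) \<Lambda>"

text \<open>
  For a functional \<open>p\<close>, the convolution product of \<open>l\<close> and \<open>p\<close> is again a left integral, hence
  proportional to \<open>l\<close>.
\<close>

lemma integral_right: "sw (\<lambda>a b. l a *\<^sub>C b) h = l h *\<^sub>C distinguished"
proof (rule functionals_separate)
  fix p :: "'h \<Rightarrow> complex" assume p: "clinear p"
  note lin = lin clinear_compose[OF p]
  define \<mu> where "\<mu> h = sw (\<lambda>a b. l a * p b) h" for h
  have p_conv: "p (sw (\<lambda>a b. l a *\<^sub>C b) h) = \<mu> h" for h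
    by (simp add: \<mu>_def clinear_sw[OF p] clinear_functional_scale[OF p])
  have "left_integral \<mu>"
    unfolding left_integral_def sw_def[symmetric]
  proof (intro conjI allI)
    show "clinear \<mu>" unfolding \<mu>_def by (intro lin)
    fix h
    have "sw (\<lambda>x y. \<mu> y *\<^sub>C x) h = sw (\<lambda>x y. sw (\<lambda>a b. (l a * p b) *\<^sub>C x) y) h"
      by (simp add: \<mu>_def clinear_sw[where f = "\<lambda>c. c *\<^sub>C _"] clinear_intros)
    also have "\<dots> = sw (\<lambda>y b. sw (\<lambda>x a. (l a * p b) *\<^sub>C x) y) h"
      by (rule sw_coassoc[symmetric]) (intro lin)+
    also have "(\<lambda>y b. sw (\<lambda>x a. (l a * p b) *\<^sub>C x) y) = (\<lambda>y b. (l y * p b) *\<^sub>C 1)"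
    proof (intro ext)
      fix y b
      have "sw (\<lambda>x a. (l a * p b) *\<^sub>C x) y = p b *\<^sub>C sw (\<lambda>x a. l a *\<^sub>C x) y"
        by (simp add: sw_scale[symmetric] scaleC_scaleC mult.commute)
      then show "sw (\<lambda>x a. (l a * p b) *\<^sub>C x) y = (l y * p b) *\<^sub>C 1"
        by (simp add: sw_integral scaleC_scaleC mult.commute)
    qed
    also have "sw (\<lambda>y b. (l y * p b) *\<^sub>C 1) h = \<mu> h *\<^sub>C 1"
      by (simp add: \<mu>_def clinear_sw[where f = "\<lambda>c. c *\<^sub>C _"] clinear_intros)
    finally show "sw (\<lambda>x y. \<mu> y *\<^sub>C x) h = \<mu> h *\<^sub>C 1" .
  qed
  then have "\<mu> h = \<mu> \<Lambda> * l h" by (rule left_integral_unique)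
  then show "p (sw (\<lambda>a b. l a *\<^sub>C b) h) = p (l h *\<^sub>C distinguished)"
    by (simp add: p_conv clinear_functional_scale[OF p] distinguished_def)
qed

lemma integral_antipode: "l (S h) = l (h * distinguished)"
proof -
  have "l (S h) = sw (\<lambda>a b. l (h * b) * l a) \<Lambda>"
    by (simp add: antipode_eq_sw_Lam[of h] clinear_sw[OF clinear_l]
        clinear_functional_scale[OF clinear_l])
  also have "\<dots> = sw (\<lambda>a b. l (h * (l a *\<^sub>C b))) \<Lambda>"
    by (simp add: mult_scaleC_right clinear_functional_scale[OF clinear_l] mult.commute)
  also have "\<dots> = l (h * distinguished)"
    unfolding distinguished_def by (rule clinear_sw[symmetric]) (intro lin)
  finally show ?thesis .
qed

text \<open>
  Radford's formula for the fourth power of the antipode, in the case of a two-sided integral \<open>\<Lambda>\<close>: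
  the Nakayama automorphism of \<open>l \<circ> S\<close> can be computed from \<open>l(S h) = l(h g)\<close> and from the
  antimultiplicativity of \<open>S\<close>.
\<close>

lemma antipode_fourth_power: "x * distinguished = distinguished * S (S (S (S x)))"
proof -
  have "l (y * (x * distinguished - distinguished * S (S (S (S x))))) = 0" for y
  proof -
    have "l (y * x * distinguished) = l (S x * S y)"
      by (simp add: integral_antipode[symmetric] antipode_mult)
    also have "\<dots> = l (S (S (S x) * y))" by (simp only: integral_Nakayama[of "S x"] antipode_mult)
    also have "\<dots> = l (y * distinguished * S (S (S (S x))))"
      by (simp only: integral_antipode mult.assoc integral_Nakayama[of "S (S x)"])
    finally show ?thesis
      by (simp add: right_diff_distrib clinearD[OF clinear_l] mult.assoc)
  qed
  from integral_nondegenerate[OF this] show ?thesis by simp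
qed

text \<open>
  The equation \<open>\<Delta> x = x \<otimes> x\<close>, tested against bilinear maps with values in \<open>H\<close>.
\<close>

definition grouplike :: "'h \<Rightarrow> bool" where
  "grouplike x \<longleftrightarrow> x \<noteq> 0 \<and> (\<forall>B :: 'h \<Rightarrow> 'h \<Rightarrow> 'h. cbilinear B \<longrightarrow> sw B x = B x x)"

lemma grouplikeD: "grouplike x \<Longrightarrow> cbilinear B \<Longrightarrow> sw B x = B x x" for B :: "'h \<Rightarrow> 'h \<Rightarrow> 'h"
  by (simp add: grouplike_def)

lemma grouplike_distinguished: "grouplike distinguished"
proof -
  have "\<epsilon> distinguished = 1"
  proof -
    have "\<epsilon> distinguished = sw (\<lambda>a b. \<epsilon> b *\<^sub>C l a) \<Lambda>"
      by (simp add: distinguished_def clinear_sw[OF counit_linear] counit_scale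
          scaleC_complex_def mult.commute)
    also have "\<dots> = l \<Lambda>" by (rule sw_counit_right) (rule clinear_l)
    finally show ?thesis by (simp add: l_Lam)
  qed
  then have "distinguished \<noteq> 0" using clinearD(3)[OF counit_linear] by auto
  moreover have "sw B distinguished = B distinguished distinguished"
    if B: "cbilinear B" for B :: "'h \<Rightarrow> 'h \<Rightarrow> 'h"
  proof -
    have B1: "clinear (\<lambda>x. B x y)" "clinear (B x)" for x y
      using B by (auto simp: cbilinear_def)
    note lin = lin clinear_compose[OF B1(1)] clinear_compose[OF B1(2)]
    have swB: "clinear (sw B)" using clinear_sw_arg[OF B clinear_intros(1)] .
    have "sw B distinguished = sw (\<lambda>a b. sw (\<lambda>p q. l a *\<^sub>C B p q) b) \<Lambda>"
      by (simp add: distinguished_def clinear_sw[OF swB] clinearD[OF swB] sw_scale)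
    also have "\<dots> = sw (\<lambda>x q. sw (\<lambda>a p. l a *\<^sub>C B p q) x) \<Lambda>"
      by (rule sw_coassoc[symmetric]) (intro lin B1)+
    also have "(\<lambda>x q. sw (\<lambda>a p. l a *\<^sub>C B p q) x) = (\<lambda>x q. B distinguished (l x *\<^sub>C q))"
    proof (intro ext)
      fix x q
      have "sw (\<lambda>a p. l a *\<^sub>C B p q) x = B (sw (\<lambda>a p. l a *\<^sub>C p) x) q"
        by (simp add: clinear_sw[OF B1(1)] clinearD[OF B1(1)])
      then show "sw (\<lambda>a p. l a *\<^sub>C B p q) x = B distinguished (l x *\<^sub>C q)"
        by (simp add: integral_right clinearD[OF B1(1)] clinearD[OF B1(2)])
    qed
    also have "sw (\<lambda>x q. B distinguished (l x *\<^sub>C q)) \<Lambda> = B distinguished distinguished"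
      by (simp add: clinear_sw[OF B1(2), symmetric]) (simp flip: distinguished_def)
    finally show ?thesis .
  qed
  ultimately show ?thesis by (simp add: grouplike_def)
qed

lemma grouplike_mult:
  assumes "grouplike x" "grouplike y" "x * y \<noteq> 0"
  shows "grouplike (x * y)"
  unfolding grouplike_def
proof (intro conjI allI impI assms(3))
  fix B :: "'h \<Rightarrow> 'h \<Rightarrow> 'h" assume B: "cbilinear B"
  then have B1: "clinear (\<lambda>x. B x y)" "clinear (B x)" for x y by (auto simp: cbilinear_def)
  note lin = lin clinear_compose[OF B1(1)] clinear_compose[OF B1(2)]
  have "cbilinear (\<lambda>c d. B (a * c) (b * d))" for a b by (intro lin)
  then have "sw B (x * y) = sw (\<lambda>a b. B (a * y) (b * y)) x"
    using assms(2) by (simp add: sw_mult[OF B] grouplike_def)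
  also have "\<dots> = B (x * y) (x * y)"
  proof -
    have "cbilinear (\<lambda>a b. B (a * y) (b * y))" by (intro lin)
    then show ?thesis by (rule grouplikeD[OF assms(1)])
  qed
  finally show "sw B (x * y) = B (x * y) (x * y)" .
qed

lemma grouplike_antipode: "grouplike x \<Longrightarrow> S x * x = 1"
proof -
  assume x: "grouplike x"
  have "sw (\<lambda>a b. S a * b) x = S x * x"
    by (rule grouplikeD[OF x]) (intro lin)
  moreover have "sw (\<lambda>a b. \<epsilon> a *\<^sub>C b) x = \<epsilon> x *\<^sub>C x"
    by (rule grouplikeD[OF x]) (intro lin)
  moreover have "sw (\<lambda>a b. \<epsilon> a *\<^sub>C b) x = x" by (rule sw_counit_left) (intro lin)
  moreover have "sw (\<lambda>a b. S a * b) x = \<epsilon> x *\<^sub>C 1" by (rule sw_antipode_left) (intro lin)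
  moreover have "x \<noteq> 0" using x by (simp add: grouplike_def)
  ultimately have "\<epsilon> x = 1" "S x * x = \<epsilon> x *\<^sub>C 1"
    by (metis cvec.scale_right_imp_eq scaleC_one, simp)
  then show ?thesis by (simp add: scaleC_one)
qed

text \<open>
  Let \<open>C\<close> be a maximal independent set of grouplike elements and \<open>x\<close> grouplike. Applying a coordinate
  functional of \<open>C\<close> to the first factor of \<open>\<Delta> x = x \<otimes> x\<close> shows that each nonzero coordinate of \<open>x\<close> belongs to
  the basis vector \<open>x\<close>, so \<open>x \<in> C\<close>.
\<close>

lemma finite_grouplike: "finite {x. grouplike x}"
proof -
  obtain C where C: "C \<subseteq> {x. grouplike x}" "cvec.independent C" "{x. grouplike x} \<subseteq> cvec.span C"
    using cvec.maximal_independent_subset[of "{x. grouplike x}"] by metis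
  define E where "E = cvec.extend_basis C"
  have E: "C \<subseteq> E" "cvec.independent E" "cvec.span E = UNIV"
    using C(2) by (simp_all add: E_def cvec.extend_basis_superset cvec.independent_extend_basis)
  define \<phi> where "\<phi> b v = cvec.representation E v b" for b v
  have \<phi>: "clinear (\<phi> b)" for b
    using E by (simp add: \<phi>_def clinear_iff cvec.representation_add cvec.representation_scale
        scaleC_complex_def)
  have "x \<in> C" if x: "grouplike x" for x
  proof (rule ccontr)
    assume xC: "x \<notin> C"
    have "\<phi> b x = 0" if b: "b \<in> C" for b
    proof (rule ccontr)
      assume "\<phi> b x \<noteq> 0"
      define T where "T y = sw (\<lambda>p q. \<phi> b p *\<^sub>C q) y - \<phi> b y *\<^sub>C b" for y
      have bil: "cbilinear (\<lambda>p q. \<phi> b p *\<^sub>C q)"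
        by (intro lin clinear_compose[OF \<phi>])
      then have T: "clinear T"
        unfolding T_def by (intro lin clinear_compose[OF \<phi>])
      have gl: "sw (\<lambda>p q. \<phi> b p *\<^sub>C q) y = \<phi> b y *\<^sub>C y" if "grouplike y" for y
        by (rule grouplikeD[OF that bil])
      have "T c = 0" if "c \<in> C" for c
      proof -
        have "\<phi> b c = (if c = b then 1 else 0)"
          unfolding \<phi>_def using E that b
          by (subst cvec.representation_basis) auto
        then show ?thesis using gl[of c] C(1) that by (auto simp: T_def)
      qed
      then have "cvec.span C \<subseteq> {y. T y = 0}"
        by (intro cvec.span_minimal) (auto simp: cvec.subspace_def clinearD[OF T])
      then have "T x = 0" using C(3) x by auto
      then have "x = b" using gl[OF x] \<open>\<phi> b x \<noteq> 0\<close> by (simp add: T_def)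
      with b xC show False by simp
    qed
    moreover have "x \<in> cvec.span C" using C(3) x by auto
    then have "x = (\<Sum>b\<in>C. \<phi> b x *\<^sub>C b)"
      using cvec.sum_representation_eq[OF C(2), of x C] fd.finiteI_independent[OF C(2)]
        cvec.representation_extend[OF E(2) _ E(1), of x] by (simp add: \<phi>_def)
    ultimately have "x = 0" by simp
    with x show False by (simp add: grouplike_def)
  qed
  then have "{x. grouplike x} \<subseteq> C" by blast
  then show ?thesis using fd.finiteI_independent[OF C(2)] by (rule finite_subset)
qed

lemma distinguished_finite_order:
  obtains m where "m > 0" "distinguished ^ m = 1"
proof -
  let ?g = distinguished
  have left_inv: "S ?g * ?g = 1" by (rule grouplike_antipode[OF grouplike_distinguished])
  have cancel: "?g ^ i * x = 0 \<Longrightarrow> x = 0" for i x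
  proof (induction i arbitrary: x)
    case (Suc i)
    then have "S ?g * ?g * (?g ^ i * x) = 0" by (simp add: mult.assoc)
    then show ?case using Suc.IH left_inv by simp
  qed simp
  have "?g ^ Suc i \<noteq> 0" for i using cancel[of "Suc i" 1] by auto
  then have gl: "grouplike (?g ^ Suc i)" for i
    by (induction i) (simp_all add: grouplike_distinguished, metis grouplike_mult grouplike_distinguished power_Suc)
  have "\<not> inj (\<lambda>i. ?g ^ Suc i)"
  proof
    assume "inj (\<lambda>i. ?g ^ Suc i)"
    then have "infinite (range (\<lambda>i. ?g ^ Suc i))" by (rule range_inj_infinite)
    moreover have "range (\<lambda>i. ?g ^ Suc i) \<subseteq> {x. grouplike x}" using gl by auto
    ultimately show False using finite_grouplike finite_subset by blast
  qed
  then obtain i j where ij: "i < j" "?g ^ Suc i = ?g ^ Suc j"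
    unfolding inj_def by (metis linorder_neqE_nat)
  have "?g ^ Suc j = ?g ^ Suc i * ?g ^ (j - i)" by (subst power_add[symmetric]) (use ij(1) in simp)
  with ij(2) have "?g ^ Suc i * (?g ^ (j - i) - 1) = 0" by (simp add: right_diff_distrib)
  from cancel[OF this] ij(1) show ?thesis by (intro that[of "j - i"]) auto
qed

lemma antipode_finite_order:
  obtains N where "N > 0" "\<And>x. ((\<lambda>x. S (S x)) ^^ N) x = x"
proof -
  obtain m where m: "m > 0" "distinguished ^ m = 1" by (rule distinguished_finite_order)
  have "x * distinguished ^ k = distinguished ^ k * ((\<lambda>x. S (S x)) ^^ (2 * k)) x" for k x
  proof (induction k arbitrary: x)
    case (Suc k)
    have "x * distinguished ^ Suc k = distinguished * (S (S (S (S x))) * distinguished ^ k)"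
      by (simp add: antipode_fourth_power flip: mult.assoc)
    also have "\<dots> = distinguished ^ Suc k * ((\<lambda>x. S (S x)) ^^ (2 * k)) (S (S (S (S x))))"
      unfolding Suc[of "S (S (S (S x)))"] by (simp only: mult.assoc power_Suc)
    also have "((\<lambda>x. S (S x)) ^^ (2 * k)) (S (S (S (S x)))) = ((\<lambda>x. S (S x)) ^^ (2 * Suc k)) x"
    proof -
      have "2 * Suc k = Suc (Suc (2 * k))" by simp
      then show ?thesis by (simp only: funpow_Suc_right o_apply)
    qed
    finally show ?case .
  qed simp
  then have "((\<lambda>x. S (S x)) ^^ (2 * m)) x = x" for x
    by (metis m(2) mult_1_left mult_1_right)
  then show ?thesis using m(1) by (intro that[of "2 * m"]) auto
qed

end

section \<open>The antipode is an involution\<close>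

locale semisimple_hopf_algebra = hopf_algebra_integral_pair \<Delta> \<epsilon> S Bas l \<Lambda> +
    semisimple_fin_dim_algebra Bas
  for \<Delta> :: "'h::complex_algebra_1 \<Rightarrow> 'h \<otimes> 'h" and \<epsilon> S Bas l \<Lambda>
begin

text \<open>
  In terms of the symmetric form of the regular character \<open>\<chi>\<close> the integral is \<open>\<chi>(u _)\<close>; its Nakayama
  automorphism \<open>S\<^sup>2\<close> is therefore conjugation by \<open>u\<close>.
\<close>

lemma antipode_square_inner:
  obtains u u' where "u * u' = 1" "u' * u = 1" "\<And>z. u * z = S (S z) * u"
proof -
  obtain u where u: "\<And>y. l y = regular_character (u * y)"
    using functional_representation[OF clinear_regular_character cvec.subspace_UNIV
        cvec.subspace_UNIV clinear_l] regular_character_nondegenerate clinearD(3)[OF clinear_l]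
    by (metis UNIV_I)
  have conj: "u * z = S (S z) * u" for z
  proof -
    have "regular_character (h * (u * z - S (S z) * u)) = 0" for h
    proof -
      have "regular_character (u * z * h) = regular_character (u * (h * S (S z)))"
        using integral_Nakayama[of z h] by (simp add: u mult.assoc)
      also have "\<dots> = regular_character (S (S z) * u * h)"
        using regular_character_commute[of "u * h" "S (S z)"] by (simp add: mult.assoc)
      finally have "regular_character ((u * z - S (S z) * u) * h) = 0"
        by (simp add: left_diff_distrib clinearD[OF clinear_regular_character])
      then show ?thesis by (simp only: regular_character_commute)
    qed
    from regular_character_nondegenerate[OF this] show ?thesis by simp
  qed
  have inj: "v = 0" if "v * u = 0" for v
  proof (rule integral_nondegenerate)
    fix x
    have "l (x * v) = regular_character (u * x * v)" by (simp add: u mult.assoc)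
    also have "\<dots> = regular_character (v * (u * x))" by (rule regular_character_commute)
    also have "v * (u * x) = 0" using that by (simp flip: mult.assoc)
    finally show "l (x * v) = 0" by (simp add: clinearD[OF clinear_regular_character])
  qed
  have "inj (\<lambda>v. v * u)"
    by (rule injI) (metis inj left_diff_distrib right_minus_eq)
  then have "surj (\<lambda>v. v * u)"
    by (intro fd.linear_inj_imp_surj) (intro lin)
  then obtain u' where u': "u' * u = 1" by (metis surjD)
  have "(1 - u * u') * u = 0" by (simp add: left_diff_distrib mult.assoc u')
  from inj[OF this] have "u * u' = 1" by simp
  with u' conj that show ?thesis by blast
qed

lemma trace_antipode_square: "trace (\<lambda>h. S (S h)) = l 1"
  using trace_mult_antipode_antipode[of 1] by simp

text \<open>
  \<open>l(1)\<close> is the trace of \<open>S\<^sup>2\<close>, an inner automorphism of finite order. On the trivial block, spanned by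
  \<open>\<Lambda>\<close>, it has trace \<open>1\<close>, and on the other blocks its trace is not negative.
\<close>

lemma integral_one_nonzero: "l 1 \<noteq> 0"
proof -
  obtain u u' where u: "u * u' = 1" "u' * u = 1" and conj: "\<And>z. u * z = S (S z) * u"
    using antipode_square_inner by metis
  obtain N where N: "N > 0" "\<And>x. ((\<lambda>x. S (S x)) ^^ N) x = x" using antipode_finite_order by metis
  have pow: "u ^ k * z = ((\<lambda>x. S (S x)) ^^ k) z * u ^ k" for k z
  proof (induction k)
    case (Suc k)
    have "u ^ Suc k * z = u * (u ^ k * z)" by (simp add: mult.assoc)
    also have "\<dots> = S (S (((\<lambda>x. S (S x)) ^^ k) z)) * (u * u ^ k)"
      by (metis Suc conj mult.assoc)
    finally show ?case by simp
  qed simp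
  have central: "u ^ N * z = z * u ^ N" for z using pow[of N z] N(2) by simp
  have S2: "S (S h) = u * h * u'" for h
    by (metis conj mult.assoc mult_1_right u(1))
  define e where "e = 1 - \<Lambda>"
  have \<Lambda>\<Lambda>: "\<Lambda> * \<Lambda> = \<Lambda>" by (simp add: Lam_left counit_Lam scaleC_one)
  have e: "e * e = e" "e * h = h * e" for h
    by (simp_all add: e_def left_diff_distrib right_diff_distrib \<Lambda>\<Lambda> Lam_left Lam_right
        clinearD(4)[OF counit_linear] counit_one counit_Lam)
  obtain r where r: "r \<ge> 0" "trace (\<lambda>h. u * h * u' * e) = complex_of_real r"
    using trace_conjugation_nonneg[OF e u N(1) central] by blast
  have "u * h * u' * \<Lambda> = \<epsilon> h *\<^sub>C \<Lambda>" for h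
  proof -
    have "\<epsilon> u * \<epsilon> u' = 1" using u(1) by (simp flip: counit_mult add: counit_one)
    then show ?thesis by (simp add: Lam_left counit_mult)
  qed
  then have "trace (\<lambda>h. u * h * u' * \<Lambda>) = 1"
    by (simp add: trace_rank_one counit_linear counit_Lam)
  moreover have "trace (\<lambda>h. S (S h)) = trace (\<lambda>h. u * h * u' * \<Lambda> + u * h * u' * e)"
    by (simp add: S2 e_def right_diff_distrib)
  ultimately have "l 1 = complex_of_real (1 + r)"
    by (simp add: trace_add r trace_antipode_square)
  then show ?thesis using r(1) by (simp only: of_real_eq_0_iff)
qed

lemma distinguished_eq_one: "distinguished = 1"
proof -
  have "l 1 *\<^sub>C distinguished = l 1 *\<^sub>C 1"
    unfolding integral_right[of 1, symmetric] by (rule sw_one) (intro lin)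
  then show ?thesis using integral_one_nonzero by simp
qed

lemma right_integral: "sw (\<lambda>a b. l a *\<^sub>C b) h = l h *\<^sub>C 1"
  by (simp add: integral_right distinguished_eq_one)

lemma antipode_fourth_power_eq: "S (S (S (S x))) = x"
  using antipode_fourth_power[of x, unfolded distinguished_eq_one mult_1_left mult_1_right]
  by (rule sym)

lemma regular_character_antipode_square: "regular_character (S (S a)) = regular_character a"
proof -
  have "(\<lambda>h. S (S a) * h) = (\<lambda>h. S (S (a * S (S h))))"
    by (simp add: antipode_mult antipode_fourth_power_eq)
  then have "regular_character (S (S a)) = trace (\<lambda>h. S (S (a * S (S h))))"
    by (simp add: regular_character_def)
  also have "\<dots> = trace (\<lambda>h. a * S (S (S (S h))))"
    by (rule trace_commute) (intro lin)+
  finally show ?thesis by (simp add: regular_character_def antipode_fourth_power_eq)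
qed

lemma regular_character_eq_integral:
  "regular_character h = l (sw (\<lambda>a b. S a * S (S b)) \<Lambda> * h)"
proof -
  have "regular_character h = trace (\<lambda>y. h * S (S (S (S y))))"
    by (simp add: regular_character_def antipode_fourth_power_eq)
  also have "\<dots> = sw (\<lambda>a b. l (h * S (S (S a)) * b)) \<Lambda>"
    by (rule trace_antipode) (intro lin)
  also have "\<dots> = l (h * sw (\<lambda>a b. S (S (S a)) * b) \<Lambda>)"
    by (simp add: clinear_sw[where f = "\<lambda>x. l (h * x)"] lin mult.assoc)
  also have "sw (\<lambda>a b. S (S (S a)) * b) \<Lambda> = S (S (sw (\<lambda>a b. S a * S (S b)) \<Lambda>))"
    by (simp add: clinear_sw[where f = "\<lambda>x. S (S x)"] lin antipode_mult antipode_fourth_power_eq)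
  finally show ?thesis by (simp only: integral_Nakayama[of _ h])
qed

text \<open>
  The tensor square of the regular representation is a direct sum of \<open>dim H\<close> copies of it. For the
  proof write \<open>\<chi> = l(w _)\<close> with \<open>w = S(\<Lambda>\<^sub>1) S\<^sup>2(\<Lambda>\<^sub>2)\<close>. Shifting \<open>l\<close> turns the claim into
  \<open>\<chi>(S w\<^sub>1) w\<^sub>2 = \<chi>(1) w\<close>, where the middle factors of \<open>\<Delta> w\<close> cancel because \<open>\<chi>\<close> is cyclic.
\<close>

lemma regular_character_convolution:
  "sw (\<lambda>a b. regular_character a * regular_character b) h = regular_character 1 * regular_character h"
proof -
  define w where "w = sw (\<lambda>a b. S a * S (S b)) \<Lambda>"
  have \<chi>: "regular_character h = l (w * h)" for h
    unfolding w_def by (rule regular_character_eq_integral)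
  define B where "B x y = regular_character (S x) *\<^sub>C y" for x y :: 'h
  have B1: "clinear (\<lambda>x. B x y)" "clinear (B x)" for x y
    unfolding B_def by (intro lin)+
  note lin = lin clinear_compose[OF B1(1)] clinear_compose[OF B1(2)]
  have bil: "cbilinear B" by (intro lin B1)
  then have swB: "clinear (sw B)" using clinear_sw_arg[OF _ clinear_intros(1)] by blast
  define T where "T p z s = regular_character (S (S z)) *\<^sub>C (S p * S (S s))" for p z s
  have "sw B w = sw (\<lambda>a b. sw B (S a * S (S b))) \<Lambda>"
    by (simp add: w_def clinear_sw[OF swB])
  also have "\<dots> = sw (\<lambda>a b. sw (\<lambda>p q. sw (\<lambda>r s. T p (q * S r) s) b) a) \<Lambda>"
  proof -
    have "sw B (S a * S (S b)) = sw (\<lambda>p q. sw (\<lambda>r s. T p (q * S r) s) b) a" for a b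
    proof -
      have "sw B (S a * S (S b)) = sw (\<lambda>p q. sw (\<lambda>r s. B (p * r) (q * s)) (S (S b))) (S a)"
        by (rule sw_mult[OF bil])
      also have "\<dots> = sw (\<lambda>p q. sw (\<lambda>r s. B (S q * r) (S p * s)) (S (S b))) a"
        by (rule sw_antipode) (intro lin)+
      also have "\<dots> = sw (\<lambda>p q. sw (\<lambda>r s. B (S q * S (S r)) (S p * S (S s))) b) a"
      proof -
        have "sw (\<lambda>r s. B (S q * r) (S p * s)) (S (S b)) =
            sw (\<lambda>r s. B (S q * S (S r)) (S p * S (S s))) b" for p q
          by (rule sw_antipode_antipode) (intro lin)+
        then show ?thesis by simp
      qed
      also have "\<dots> = sw (\<lambda>p q. sw (\<lambda>r s. T p (q * S r) s) b) a"
      proof -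
        have "B (S q * S (S r)) (S p * S (S s)) = T p (q * S r) s" for p q r s
          using regular_character_commute[of "S (S (S r))" "S (S q)"]
          by (simp add: B_def T_def antipode_mult)
        then show ?thesis by simp
      qed
      finally show ?thesis .
    qed
    then show ?thesis by simp
  qed
  also have "\<dots> = sw (\<lambda>p y. sw (\<lambda>q b. sw (\<lambda>r s. T p (q * S r) s) b) y) \<Lambda>"
    unfolding T_def by (rule sw_coassoc) (intro lin)+
  also have "\<dots> = sw (\<lambda>p y. regular_character 1 *\<^sub>C (S p * S (S y))) \<Lambda>"
  proof -
    have "sw (\<lambda>q b. sw (\<lambda>r s. T p (q * S r) s) b) y = regular_character 1 *\<^sub>C (S p * S (S y))"
      for p y
    proof -
      have "sw (\<lambda>q b. sw (\<lambda>r s. T p (q * S r) s) b) y = sw (\<lambda>x s. sw (\<lambda>q r. T p (q * S r) s) x) y"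
        unfolding T_def by (rule sw_coassoc[symmetric]) (intro lin)+
      also have "\<dots> = sw (\<lambda>x s. \<epsilon> x *\<^sub>C T p 1 s) y"
      proof -
        have "sw (\<lambda>q r. T p (q * S r) s) x = \<epsilon> x *\<^sub>C T p 1 s" for x s
          by (rule sw_antipode_right) (unfold T_def, intro lin)
        then show ?thesis by simp
      qed
      also have "\<dots> = T p 1 y"
        by (rule sw_counit_left) (unfold T_def, intro lin)
      finally show ?thesis by (simp add: T_def antipode_one)
    qed
    then show ?thesis by simp
  qed
  finally have sww: "sw B w = regular_character 1 *\<^sub>C w" by (simp add: sw_scale w_def)
  have "sw (\<lambda>a b. regular_character a * regular_character b) h =
      regular_character (sw (\<lambda>a b. l (w * b) *\<^sub>C a) h)"
    by (simp add: clinear_sw[OF clinear_regular_character]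
        clinear_functional_scale[OF clinear_regular_character] \<chi>[symmetric] mult.commute)
  also have "\<dots> = sw (\<lambda>c d. l (B c d * h)) w"
    by (simp add: l_shift clinear_sw[OF clinear_regular_character] B_def mult_scaleC_left
        clinear_functional_scale[OF clinear_regular_character]
        clinear_functional_scale[OF clinear_l] mult.commute)
  also have "\<dots> = l (sw B w * h)"
    by (rule clinear_sw[symmetric]) (intro lin)
  finally show ?thesis
    by (simp add: sww mult_scaleC_left clinear_functional_scale[OF clinear_l] \<chi>)
qed

text \<open>
  Convolution with the regular character is \<open>n = dim H\<close> times an idempotent that commutes with the
  involution \<open>S\<^sup>2\<close>. The trace of \<open>S\<^sup>2\<close> on the range of this idempotent is \<open>l(1) / n\<close>, and the trace of an
  involution is an integer.
\<close>

lemma integral_one_divisible: "\<exists>k :: int. l 1 = regular_character 1 * of_int k"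
proof -
  define n where "n = regular_character 1"
  have n: "n \<noteq> 0" using regular_character_idempotent[of 1] by (auto simp: n_def)
  define M where "M y = sw (\<lambda>a b. regular_character a *\<^sub>C b) y" for y
  have M_lin: "clinear M" unfolding M_def by (intro lin)
  note lin = lin clinear_compose[OF M_lin]
  have MM: "M (M y) = n *\<^sub>C M y" for y
  proof -
    have "M (M y) = sw (\<lambda>a b. regular_character a *\<^sub>C M b) y"
      by (subst (2) M_def) (simp add: clinear_sw[OF M_lin] clinearD[OF M_lin])
    also have "\<dots> = sw (\<lambda>a b. sw (\<lambda>c d. (regular_character a * regular_character c) *\<^sub>C d) b) y"
      by (simp add: M_def sw_scale[symmetric] scaleC_scaleC)
    also have "\<dots> = sw (\<lambda>x d. sw (\<lambda>a c. (regular_character a * regular_character c) *\<^sub>C d) x) y"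
      by (rule sw_coassoc[symmetric]) (intro lin)+
    also have "\<dots> = sw (\<lambda>x d. n *\<^sub>C regular_character x *\<^sub>C d) y"
    proof -
      have "sw (\<lambda>a c. (regular_character a * regular_character c) *\<^sub>C d) x =
          n *\<^sub>C regular_character x *\<^sub>C d" for x d :: 'h
        by (subst clinear_sw[where f = "\<lambda>c. c *\<^sub>C d", symmetric])
          (intro lin, simp add: regular_character_convolution n_def scaleC_scaleC)
      then show ?thesis by simp
    qed
    finally show ?thesis by (simp only: sw_scale M_def)
  qed
  have MS: "M (S (S y)) = S (S (M y))" for y
  proof -
    have "M (S (S y)) = sw (\<lambda>a b. regular_character (S (S a)) *\<^sub>C S (S b)) y"
      unfolding M_def by (rule sw_antipode_antipode) (intro lin)+
    also have "\<dots> = S (S (M y))"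
      unfolding M_def
      by (simp add: clinear_sw[where f = "\<lambda>x. S (S x)"] lin regular_character_antipode_square
          clinearD(2)[OF antipode_linear])
    finally show ?thesis .
  qed
  have trace_SM: "trace (\<lambda>h. S (S (M h))) = l 1"
  proof -
    have "trace (\<lambda>h. S (S (M h))) = trace (\<lambda>h. S (M (S h)))"
      by (rule trace_commute) (intro lin)+
    also have "\<dots> = sw (\<lambda>a b. l (S (M a) * b)) \<Lambda>"
      by (rule trace_antipode) (intro lin)
    also have "\<dots> = sw (\<lambda>a b. sw (\<lambda>p q. regular_character p * l (S q * b)) a) \<Lambda>"
    proof -
      have "l (S (M a) * b) = sw (\<lambda>p q. regular_character p * l (S q * b)) a" for a b
        unfolding M_def
        by (subst clinear_sw[where f = "\<lambda>x. l (S x * b)"])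
          (intro lin, simp add: mult_scaleC_left clinear_functional_scale[OF clinear_l]
            clinearD(2)[OF antipode_linear])
      then show ?thesis by simp
    qed
    also have "\<dots> = sw (\<lambda>p y. sw (\<lambda>q b. regular_character p * l (S q * b)) y) \<Lambda>"
      by (rule sw_coassoc) (intro lin)+
    also have "\<dots> = sw (\<lambda>p y. \<epsilon> y *\<^sub>C (regular_character p * l 1)) \<Lambda>"
    proof -
      have "sw (\<lambda>q b. regular_character p * l (S q * b)) y = \<epsilon> y *\<^sub>C (regular_character p * l 1)"
        for p y
        by (rule sw_antipode_left) (intro lin)
      then show ?thesis by simp
    qed
    also have "\<dots> = regular_character \<Lambda> * l 1"
      by (rule sw_counit_right) (intro lin)
    also have "regular_character \<Lambda> = 1"
      by (simp add: regular_character_def Lam_right trace_rank_one counit_linear counit_Lam)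
    finally show ?thesis by simp
  qed
  \<comment> \<open>The projections to the eigenspaces of \<open>S\<^sup>2\<close> on the range of \<open>M\<close>, for \<open>\<sigma> = 1\<close> and \<open>\<sigma> = - 1\<close>.\<close>
  define Q where "Q \<sigma> h = (1 / (2 * n)) *\<^sub>C (M h + \<sigma> *\<^sub>C S (S (M h)))" for \<sigma> h
  have Q_lin: "clinear (Q \<sigma>)" for \<sigma> unfolding Q_def by (intro lin)
  have Q_idem: "Q \<sigma> (Q \<sigma> h) = Q \<sigma> h" if "\<sigma> * \<sigma> = 1" for \<sigma> h
  proof -
    have MQ: "M (Q \<sigma> h) = (1 / 2) *\<^sub>C (M h + \<sigma> *\<^sub>C S (S (M h)))"
      using n by (simp add: Q_def clinearD[OF M_lin] MS MM scaleC_add_right scaleC_scaleC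
          clinearD[OF antipode_linear] mult.commute)
    have "S (S (M (Q \<sigma> h))) = (1 / 2) *\<^sub>C (S (S (M h)) + \<sigma> *\<^sub>C M h)"
      by (simp add: MQ clinearD[OF antipode_linear] antipode_fourth_power_eq)
    then have "M (Q \<sigma> h) + \<sigma> *\<^sub>C S (S (M (Q \<sigma> h))) =
        (1 / 2) *\<^sub>C (M h + \<sigma> *\<^sub>C S (S (M h)) + (\<sigma> *\<^sub>C S (S (M h)) + (\<sigma> * \<sigma>) *\<^sub>C M h))"
      by (simp add: MQ scaleC_add_right scaleC_scaleC mult.commute)
    also have "\<dots> = (1 / 2 + 1 / 2) *\<^sub>C (M h + \<sigma> *\<^sub>C S (S (M h)))"
      unfolding that scaleC_add_left by (simp add: scaleC_add_right scaleC_one)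
    finally show ?thesis
      unfolding Q_def[of \<sigma> "Q \<sigma> h"] by (simp add: scaleC_one) (simp add: Q_def)
  qed
  have "trace (Q 1) - trace (Q (- 1)) = trace (\<lambda>h. Q 1 h - Q (- 1) h)"
    by (rule trace_diff[symmetric])
  also have "(\<lambda>h. Q 1 h - Q (- 1) h) = (\<lambda>h. (1 / n) *\<^sub>C S (S (M h)))"
  proof
    fix h
    have "Q 1 h - Q (- 1) h = (1 / (2 * n) + 1 / (2 * n)) *\<^sub>C S (S (M h))"
      unfolding scaleC_add_left by (simp add: Q_def scaleC_add_right scaleC_one cvec.scale_right_diff_distrib)
    then show "Q 1 h - Q (- 1) h = (1 / n) *\<^sub>C S (S (M h))" using n by (simp add: field_simps)
  qed
  also have "trace \<dots> = l 1 / n" by (simp add: trace_scale trace_SM)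
  finally have "l 1 = n * (trace (Q 1) - trace (Q (- 1)))" using n by simp
  moreover have "trace (Q 1) = of_nat (cvec.dim (range (Q 1)))"
      "trace (Q (- 1)) = of_nat (cvec.dim (range (Q (- 1))))"
    by (rule trace_idempotent[OF Q_lin Q_idem]; simp)+
  ultimately show ?thesis
    by (intro exI[of _ "int (cvec.dim (range (Q 1))) - int (cvec.dim (range (Q (- 1))))"])
      (simp add: n_def)
qed

text \<open>
  Let \<open>a\<close> and \<open>b\<close> be the multiplicities of the eigenvalues \<open>1\<close> and \<open>- 1\<close> of \<open>S\<^sup>2\<close>. Then \<open>a - b = l(1)\<close> is a
  nonzero multiple of \<open>a + b = dim H\<close>, so one of them is zero, and \<open>S\<^sup>2\<close> fixes \<open>1\<close>.
\<close>

lemma antipode_involutive: "S (S x) = x"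
proof -
  define P where "P \<sigma> h = (1 / 2) *\<^sub>C (h + \<sigma> *\<^sub>C S (S h))" for \<sigma> h
  have P_lin: "clinear (P \<sigma>)" for \<sigma> unfolding P_def by (intro lin)
  have P_idem: "P \<sigma> (P \<sigma> h) = P \<sigma> h" if "\<sigma> * \<sigma> = 1" for \<sigma> h
  proof -
    have "S (S (P \<sigma> h)) = (1 / 2) *\<^sub>C (S (S h) + \<sigma> *\<^sub>C h)"
      by (simp add: P_def clinearD[OF antipode_linear] antipode_fourth_power_eq)
    then have "P \<sigma> h + \<sigma> *\<^sub>C S (S (P \<sigma> h)) =
        (1 / 2) *\<^sub>C (h + \<sigma> *\<^sub>C S (S h) + (\<sigma> *\<^sub>C S (S h) + (\<sigma> * \<sigma>) *\<^sub>C h))"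
      by (simp add: P_def scaleC_add_right scaleC_scaleC mult.commute)
    also have "\<dots> = (1 / 2 + 1 / 2) *\<^sub>C (h + \<sigma> *\<^sub>C S (S h))"
      unfolding that scaleC_add_left by (simp add: scaleC_add_right scaleC_one)
    finally show ?thesis
      unfolding P_def[of \<sigma> "P \<sigma> h"] by (simp add: scaleC_one) (simp add: P_def)
  qed
  define a b where "a = cvec.dim (range (P 1))" and "b = cvec.dim (range (P (- 1)))"
  have ab: "trace (P 1) = of_nat a" "trace (P (- 1)) = of_nat b"
    unfolding a_def b_def by (rule trace_idempotent[OF P_lin P_idem]; simp)+
  have half: "(1 / 2) *\<^sub>C y + (1 / 2) *\<^sub>C y = y" for y :: 'h
    by (simp add: scaleC_one flip: scaleC_add_left)
  have sum: "P 1 h + P (- 1) h = h" and diff: "P 1 h - P (- 1) h = S (S h)" for h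
    by (simp_all add: P_def scaleC_add_right scaleC_one cvec.scale_right_diff_distrib half)
  have "of_nat a + of_nat b = regular_character 1"
    by (simp add: regular_character_def sum flip: ab trace_add)
  moreover have "of_nat a - of_nat b = l 1"
    by (simp add: diff trace_antipode_square flip: ab trace_diff)
  moreover obtain k :: int where "l 1 = regular_character 1 * of_int k"
    using integral_one_divisible by blast
  ultimately have "(of_nat a - of_nat b :: complex) = (of_nat a + of_nat b) * of_int k" by simp
  then have "(of_int (int a - int b) :: complex) = of_int ((int a + int b) * k)" by simp
  then have eq: "int a - int b = (int a + int b) * k" by (simp only: of_int_eq_iff)
  have "k \<noteq> 0"
    using integral_one_nonzero \<open>l 1 = _\<close> by auto
  have "a = 0 \<or> b = 0"
  proof (rule ccontr)
    assume "\<not> (a = 0 \<or> b = 0)"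
    then have "\<bar>int a - int b\<bar> < int a + int b" by auto
    moreover have "int a + int b \<le> (int a + int b) * \<bar>k\<bar>"
      using \<open>k \<noteq> 0\<close> by (intro mult_le_cancel_left1[THEN iffD2]) auto
    ultimately show False using eq by (simp add: abs_mult)
  qed
  moreover have "a \<noteq> 0"
  proof
    assume "a = 0"
    then have "P 1 1 = 0"
      using ab by (intro trace_idempotent_eq_0[OF P_lin P_idem]) auto
    moreover have "P 1 1 = 1"
      using half[of 1] by (simp only: P_def antipode_one scaleC_add_right scaleC_one)
    ultimately show False by simp
  qed
  ultimately have "b = 0" by blast
  then have "P (- 1) x = 0"
    using ab by (intro trace_idempotent_eq_0[OF P_lin P_idem]) auto
  with sum[of x] diff[of x] show ?thesis by simp
qed

lemma integral_eq_regular_character: "l x = regular_character x"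
  using trace_mult_antipode_antipode[of x]
  by (simp add: regular_character_def antipode_involutive)

end

section \<open>Coideal subalgebras\<close>

lemma tensor_space_cong:
  assumes "t \<in> tensor_space V W" "cbilinear B" "cbilinear C"
    and "\<And>x y. x \<in> V \<Longrightarrow> y \<in> W \<Longrightarrow> B x y = C x y"
  shows "tensor_lift B t = tensor_lift C t"
proof -
  have "clinear (\<lambda>t. tensor_lift B t - tensor_lift C t)"
    using assms(2,3) by (intro clinear_intros tensor_lift_linear)
  note lin = clinearD[OF this]
  have "cvec.span {x \<otimes> y | x y. x \<in> V \<and> y \<in> W} \<subseteq> {t. tensor_lift B t - tensor_lift C t = 0}"
  proof (rule cvec.span_minimal)
    show "cvec.subspace {t. tensor_lift B t - tensor_lift C t = 0}"
      unfolding cvec.subspace_def mem_Collect_eq lin by simp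
  qed (auto simp: tensor_lift_tensor_of assms)
  then show ?thesis using assms(1) by (auto simp: tensor_space_def)
qed

lemma tensor_lift_mem:
  assumes "t \<in> tensor_space V W" "cbilinear B" "cvec.subspace U"
    and "\<And>x y. x \<in> V \<Longrightarrow> y \<in> W \<Longrightarrow> B x y \<in> U"
  shows "tensor_lift B t \<in> U"
proof -
  note lin = clinearD[OF tensor_lift_linear[OF assms(2)]]
  have "cvec.span {x \<otimes> y | x y. x \<in> V \<and> y \<in> W} \<subseteq> {t. tensor_lift B t \<in> U}"
  proof (rule cvec.span_minimal)
    show "cvec.subspace {t. tensor_lift B t \<in> U}"
      using assms(3) unfolding cvec.subspace_def mem_Collect_eq lin by simp
  qed (auto simp: tensor_lift_tensor_of assms)
  then show ?thesis using assms(1) by (auto simp: tensor_space_def)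
qed

lemma (in hopf_algebra) hopf_subalgebra_imp_left_coideal_subalgebra:
  assumes "hopf_subalgebra K"
  shows "left_coideal_subalgebra K"
proof -
  have "tensor_space K K \<subseteq> tensor_space UNIV K"
    unfolding tensor_space_def by (rule cvec.span_mono) blast
  then show ?thesis
    using assms by (auto simp: hopf_subalgebra_def left_coideal_subalgebra_def)
qed

context semisimple_hopf_algebra
begin

lemma integral_commute: "l (x * y) = l (y * x)"
  by (simp only: integral_eq_regular_character regular_character_commute[of x y])

text \<open>
  If \<open>x\<close> lies in the radical, then \<open>l(x\<^sup>i) = 0\<close> for all \<open>i \<ge> 1\<close>, so the span of these powers contains no nonzero
  idempotent, as \<open>l\<close> is the regular character; therefore \<open>\<epsilon>(x) = 0\<close>. Since \<open>\<epsilon>\<close> vanishes on the radical,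
  its restriction to \<open>L\<close> is \<open>l(k _)\<close> for some \<open>k\<close> in \<open>L\<close>, and \<open>x = x\<^sub>1 l(k x\<^sub>2) = S(k\<^sub>1) l(k\<^sub>2 x) = 0\<close>.
\<close>

lemma integral_nondegenerate_on_left_coideal_subalgebra:
  assumes L: "left_coideal_subalgebra L"
    and x: "x \<in> L" "\<And>k. k \<in> L \<Longrightarrow> l (k * x) = 0"
  shows "x = 0"
proof -
  have sub: "cvec.subspace L" "1 \<in> L" "\<And>a b. a \<in> L \<Longrightarrow> b \<in> L \<Longrightarrow> a * b \<in> L"
    and co: "\<And>h. h \<in> L \<Longrightarrow> \<Delta> h \<in> tensor_space UNIV L"
    using L by (auto simp: left_coideal_subalgebra_def unital_subalgebra_def)
  have counit0: "\<epsilon> y = 0" if y: "y \<in> L" "\<And>k. k \<in> L \<Longrightarrow> l (k * y) = 0" for y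
  proof (rule ccontr)
    assume "\<epsilon> y \<noteq> 0"
    then obtain e where e: "e \<in> cvec.span ((\<lambda>i. y ^ i) ` {1..})" "e * e = e" "e \<noteq> 0"
      using exists_idempotent_in_powers[of \<epsilon> y] counit_mult counit_one clinearD(3)[OF counit_linear]
      by metis
    have "y ^ i \<in> L" for i by (induction i) (auto simp: sub y)
    then have "l (y ^ Suc i) = 0" for i
      using y(2)[of "y ^ i"] by (simp add: power_commutes)
    then have "l (y ^ i) = 0" if "i \<ge> 1" for i using that by (cases i) auto
    then have "cvec.span ((\<lambda>i. y ^ i) ` {1..}) \<subseteq> {a. l a = 0}"
      by (intro cvec.span_minimal) (auto simp: cvec.subspace_def clinearD[OF clinear_l])
    with e show False
      using regular_character_idempotent[OF e(2)] integral_eq_regular_character[of e] by auto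
  qed
  obtain k where k: "k \<in> L" "\<And>y. y \<in> L \<Longrightarrow> \<epsilon> y = l (k * y)"
    using functional_representation[OF clinear_l sub(1) sub(1) counit_linear counit0] by metis
  have "x = sw (\<lambda>a b. \<epsilon> b *\<^sub>C a) x" by (simp add: sw_def counit_right)
  also have "\<dots> = sw (\<lambda>a b. l (k * b) *\<^sub>C a) x"
    unfolding sw_def by (rule tensor_space_cong[OF co[OF x(1)]]; (intro lin)?) (simp add: k)
  also have "\<dots> = sw (\<lambda>c d. l (d * x) *\<^sub>C S c) k" by (rule l_shift)
  also have "\<dots> = sw (\<lambda>c d. 0 *\<^sub>C S c) k"
    unfolding sw_def
    by (rule tensor_space_cong[OF co[OF k(1)]]; (intro lin)?) (simp_all add: x(2) cbilinear_def clinear_iff)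
  finally show ?thesis by (simp add: sw_eq_0)
qed

text \<open>
  The mirror image of \<open>l_shift\<close>, for the right integral property of \<open>l\<close>.
\<close>

lemma right_integral_shift:
  "sw (\<lambda>a b. l (a * k) *\<^sub>C b) h = sw (\<lambda>c d. l (h * c) *\<^sub>C S d) k"
proof -
  define G where "G p q s = sw (\<lambda>a b. l (a * p) *\<^sub>C (b * (q * s))) h" for p q s
  have "l (h * c) *\<^sub>C S d = sw (\<lambda>p q. G p q (S d)) c" for c d
  proof -
    have "l (h * c) *\<^sub>C S d = sw (\<lambda>a b. l a *\<^sub>C b) (h * c) * S d"
      by (simp add: right_integral mult_scaleC_left)
    also have "sw (\<lambda>a b. l a *\<^sub>C b) (h * c) = sw (\<lambda>a b. sw (\<lambda>p q. l (a * p) *\<^sub>C (b * q)) c) h"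
      by (rule sw_mult) (intro lin)
    also have "\<dots> = sw (\<lambda>p q. sw (\<lambda>a b. l (a * p) *\<^sub>C (b * q)) h) c"
      by (rule sw_swap)
    also have "\<dots> * S d = sw (\<lambda>p q. G p q (S d)) c"
      by (simp add: clinear_sw[where f = "\<lambda>x. x * S d"] clinear_intros G_def mult_scaleC_left mult.assoc)
    finally show ?thesis .
  qed
  then have "sw (\<lambda>c d. l (h * c) *\<^sub>C S d) k = sw (\<lambda>c d. sw (\<lambda>p q. G p q (S d)) c) k"
    by simp
  also have "\<dots> = sw (\<lambda>p y. sw (\<lambda>q d. G p q (S d)) y) k"
    unfolding G_def by (rule sw_coassoc) (intro lin)+
  also have "\<dots> = sw (\<lambda>p y. \<epsilon> y *\<^sub>C G p 1 1) k"
  proof -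
    have "sw (\<lambda>q d. G p q (S d)) y = \<epsilon> y *\<^sub>C G p 1 1" for p y
    proof -
      have "clinear (\<lambda>z. sw (\<lambda>a b. l (a * p) *\<^sub>C (b * z)) h)" by (intro lin)
      from sw_antipode_right[OF this, of y] show ?thesis by (simp add: G_def)
    qed
    then show ?thesis by simp
  qed
  also have "\<dots> = G k 1 1"
    unfolding G_def by (rule sw_counit_right) (intro lin)
  finally show ?thesis by (simp add: G_def)
qed

text \<open>
  Choose \<open>z\<close> in \<open>K\<close> with \<open>l(z y) = \<epsilon>(y)\<close> on \<open>K\<close>. The map \<open>E h = l(h\<^sub>1 z) h\<^sub>2 = l(h z\<^sub>1) S(z\<^sub>2)\<close> fixes \<open>K\<close>
  pointwise and maps \<open>L\<close> into \<open>L\<close>. It kills an element \<open>v = x + y\<close> of the radical, since \<open>z\<^sub>1\<close> stays in \<open>K\<close>.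
  So \<open>y = - E x\<close> lies in \<open>L\<close>, and \<open>v\<close> lies in the radical of \<open>l\<close> on \<open>L\<close>.
\<close>

lemma integral_nondegenerate_on_sum:
  assumes K: "hopf_subalgebra K" and L: "left_coideal_subalgebra L"
    and v: "v \<in> {x + y | x y. x \<in> L \<and> y \<in> K}"
    and rad: "\<And>w. w \<in> {x + y | x y. x \<in> L \<and> y \<in> K} \<Longrightarrow> l (v * w) = 0"
  shows "v = 0"
proof -
  have KL: "left_coideal_subalgebra K" by (rule hopf_subalgebra_imp_left_coideal_subalgebra[OF K])
  have subK: "cvec.subspace K" and coK: "\<And>h. h \<in> K \<Longrightarrow> \<Delta> h \<in> tensor_space K K"
    using K by (auto simp: hopf_subalgebra_def unital_subalgebra_def)
  have subL: "cvec.subspace L" and coL: "\<And>h. h \<in> L \<Longrightarrow> \<Delta> h \<in> tensor_space UNIV L"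
    using L by (auto simp: left_coideal_subalgebra_def unital_subalgebra_def)
  have radK: "l (v * w) = 0" if "w \<in> K" for w
  proof -
    have "0 + w \<in> {x + y | x y. x \<in> L \<and> y \<in> K}" using that cvec.subspace_0[OF subL] by blast
    from rad[OF this] show ?thesis by simp
  qed
  have radL: "l (v * w) = 0" if "w \<in> L" for w
  proof -
    have "w + 0 \<in> {x + y | x y. x \<in> L \<and> y \<in> K}" using that cvec.subspace_0[OF subK] by blast
    from rad[OF this] show ?thesis by simp
  qed
  have "\<epsilon> y = 0" if "y \<in> K" "\<And>k. k \<in> K \<Longrightarrow> l (k * y) = 0" for y
    using integral_nondegenerate_on_left_coideal_subalgebra[OF KL that] clinearD(3)[OF counit_linear]
    by simp
  then obtain z where z: "z \<in> K" "\<And>y. y \<in> K \<Longrightarrow> \<epsilon> y = l (z * y)"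
    using functional_representation[OF clinear_l subK subK counit_linear] by metis
  define E where "E h = sw (\<lambda>a b. l (a * z) *\<^sub>C b) h" for h
  have bil: "cbilinear (\<lambda>a b. l (a * z) *\<^sub>C b)" by (intro lin)
  have E_lin: "clinear E" unfolding E_def by (intro lin)
  obtain x y where xy: "x \<in> L" "y \<in> K" "v = x + y" using v by blast
  have "E v = sw (\<lambda>c d. l (v * c) *\<^sub>C S d) z"
    unfolding E_def by (rule right_integral_shift)
  also have "\<dots> = sw (\<lambda>c d. 0 *\<^sub>C S d) z"
    unfolding sw_def
    by (rule tensor_space_cong[OF coK[OF z(1)]]; (intro lin)?) (simp_all add: radK cbilinear_def clinear_iff)
  finally have "E v = 0" by (simp add: sw_eq_0)
  moreover have "E y = y"
  proof -
    have "E y = sw (\<lambda>a b. \<epsilon> a *\<^sub>C b) y"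
      unfolding E_def sw_def
      by (rule tensor_space_cong[OF coK[OF xy(2)]]; (intro lin)?) (simp add: z(2) integral_commute[of _ z])
    then show ?thesis by (simp add: sw_def counit_left)
  qed
  moreover have "E x \<in> L"
    unfolding E_def sw_def
    by (rule tensor_lift_mem[OF coL[OF xy(1)] bil subL]) (intro cvec.subspace_scale subL)
  ultimately have "v = x - E x" "E x \<in> L"
    using clinearD(1)[OF E_lin, of x y] by (simp_all add: xy(3) eq_neg_iff_add_eq_0 add.commute)
  then have "v \<in> L" using xy(1) subL by (simp add: cvec.subspace_diff)
  then show ?thesis
    using integral_nondegenerate_on_left_coideal_subalgebra[OF L] radL integral_commute by metis
qed

end

text \<open>
  A complement of the left ideal \<open>ker \<epsilon>\<close> is spanned by an integral.
\<close>

lemma (in semisimple_fin_dim_algebra) exists_normalized_integral: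
  assumes \<epsilon>: "clinear \<epsilon>" "\<And>x y. \<epsilon> (x * y) = \<epsilon> x * \<epsilon> (y :: 'a)" "\<epsilon> 1 = (1 :: complex)"
  obtains \<Lambda> where "\<And>h. h * \<Lambda> = \<epsilon> h *\<^sub>C \<Lambda>" "\<epsilon> \<Lambda> = 1"
proof -
  define I where "I = {x. \<epsilon> x = 0}"
  have I: "left_ideal I"
    by (auto simp: left_ideal_def I_def cvec.subspace_def clinearD[OF \<epsilon>(1)] \<epsilon>(2))
  obtain J where J: "left_ideal J" "I \<inter> J = {0}" "\<And>z. \<exists>x\<in>I. \<exists>y\<in>J. z = x + y"
    using left_ideal_complement[OF I] by metis
  from J(3)[of 1] obtain e f where ef: "e \<in> I" "f \<in> J" "1 = e + f" by blast
  have f1: "\<epsilon> f = 1"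
    using ef(1) \<epsilon>(3) clinearD(1)[OF \<epsilon>(1), of e f] by (simp add: I_def flip: ef(3))
  moreover have "h * f = \<epsilon> h *\<^sub>C f" for h
  proof -
    have "h * f - \<epsilon> h *\<^sub>C f \<in> J"
      using J(1) ef(2) by (auto simp: left_ideal_def intro: cvec.subspace_diff cvec.subspace_scale)
    moreover have "h * f - \<epsilon> h *\<^sub>C f \<in> I"
      by (simp add: I_def clinearD[OF \<epsilon>(1)] \<epsilon>(2) f1 scaleC_complex_def)
    ultimately show ?thesis using J(2) by (metis IntI right_minus_eq singletonD)
  qed
  ultimately show ?thesis using that by blast
qed

theorem theorem11p26:
  fixes \<Delta> :: "'h::complex_algebra_1 \<Rightarrow> 'h \<otimes> 'h"
    and \<epsilon> :: "'h \<Rightarrow> complex"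
    and S :: "'h \<Rightarrow> 'h"
    and l :: "'h \<Rightarrow> complex"
    and K L :: "'h set"
  assumes "hopf_algebra \<Delta> \<epsilon> S"
    and "fin_dim TYPE('h)"
    and "semisimple_algebra TYPE('h)"
    and "hopf_algebra.left_integral \<Delta> l"
    and "l \<noteq> (\<lambda>h. 0)"
    and "hopf_algebra.hopf_subalgebra \<Delta> S K"
    and "hopf_algebra.left_coideal_subalgebra \<Delta> L"
  shows "nondegenerate_on l {x + y | x y. x \<in> L \<and> y \<in> K}"
proof -
  obtain Bas :: "'h set" where Bas: "fin_dim_space Bas"
    using fin_dim_imp_fin_dim_space[OF assms(2)] .
  interpret hopf_algebra \<Delta> \<epsilon> S by (fact assms(1))
  interpret A: semisimple_fin_dim_algebra Bas
    using Bas assms(3)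
    by (simp add: semisimple_fin_dim_algebra_def semisimple_fin_dim_algebra_axioms_def
        fin_dim_algebra_def)
  interpret I: hopf_algebra_with_integral \<Delta> \<epsilon> S Bas l
    using assms(4,5) by unfold_locales
  obtain \<Lambda> where \<Lambda>: "\<And>h. h * \<Lambda> = \<epsilon> h *\<^sub>C \<Lambda>" "\<epsilon> \<Lambda> = 1"
    using A.exists_normalized_integral[OF counit_linear counit_mult counit_one] by metis
  then have "\<Lambda> \<noteq> 0" using clinearD(3)[OF counit_linear] by auto
  with I.integral_nonzero_on_integral[OF \<Lambda>(1)] have l\<Lambda>: "l \<Lambda> \<noteq> 0" by simp
  \<comment> \<open>Nondegeneracy is insensitive to the scaling that achieves \<open>l'(\<Lambda>) = 1\<close>.\<close>
  define l' where "l' h = inverse (l \<Lambda>) *\<^sub>C l h" for h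
  have l': "l' h = inverse (l \<Lambda>) * l h" for h by (simp add: l'_def scaleC_complex_def)
  have "left_integral l'"
    unfolding left_integral_def sw_def[symmetric]
  proof (intro conjI allI)
    show "clinear l'" unfolding l'_def by (intro clinear_intros I.clinear_l)
    show "sw (\<lambda>x y. l' y *\<^sub>C x) h = l' h *\<^sub>C 1" for h
      by (simp add: l' sw_scale I.sw_integral flip: scaleC_scaleC)
  qed
  moreover have "l' \<noteq> (\<lambda>h. 0)" using l\<Lambda> by (auto simp: l' fun_eq_iff intro!: exI[of _ \<Lambda>])
  ultimately interpret semisimple_hopf_algebra \<Delta> \<epsilon> S Bas l' \<Lambda>
    using \<Lambda> l\<Lambda> by unfold_locales (simp_all add: l')
  have zero: "l' h = 0 \<longleftrightarrow> l h = 0" for h using l\<Lambda> by (simp add: l')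
  let ?V = "{x + y | x y. x \<in> L \<and> y \<in> K}"
  have left: "v = 0" if "v \<in> ?V" "\<forall>w\<in>?V. l' (v * w) = 0" for v
    using integral_nondegenerate_on_sum[OF assms(6,7) that(1)] that(2) by blast
  have right: "v = 0" if "v \<in> ?V" "\<forall>w\<in>?V. l' (w * v) = 0" for v
    using that(2) by (intro left[OF that(1)]) (simp only: integral_commute[of v])
  show ?thesis
    unfolding nondegenerate_on_def zero[symmetric] using left right by blast
qed

end
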